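(* Let $\mu$ be the Borel probability measure on $\mathbb{R}$ determined by $\mu=\frac12\left(\mu\circ\tau_0^{-1}+\mu\circ\tau_2^{-1}\right)$ with $\tau_b(x)=(x+b)/4$, and let $\Gamma_1=\{\sum_{j=0}^n a_j4^j : a_j\in\{0,1\},\ n\ge 0\}$. Then $$0<\mathcal D_{1/2}^+(\Gamma_1)<\infty,\qquad \mathcal D_{1/2}^+(5^k\Gamma_1)=\frac{1}{(5^k)^{1/2}}\,\mathcal D_{1/2}^+(\Gamma_1)\ \text{ for all integers } k\ge 0,\qquad \lim_{k\to\infty}\mathcal D_{1/2}^+(5^k\Gamma_1)=0.$$ Consequently, orthonormal bases of complex exponentials for $L^2(\mu)$ can have arbitrarily small $\frac12$-upper Beurling density: for every $\varepsilon>0$ there is a set $\Lambda\subset\mathbb{R}$ such that $\{e^{2\pi i\lambda x} : \lambda\in\Lambda\}$ is an orthonormal basis of $L^2(\mu)$ and $\mathcal D_{1/2}^+(\Lambda)<\varepsilon$.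
   Context: For a discrete set $\Lambda\subset\mathbb{R}^d$ and $\alpha>0$, the $\alpha$-upper Beurling density of $\Lambda$ is $$\mathcal D_\alpha^+(\Lambda)=\limsup_{h\to\infty}\ \sup_{x\in\mathbb{R}^d}\frac{\#\left(\Lambda\cap(x+h[-1,1]^d)\right)}{h^\alpha}.$$ Here $d=1$. The exponent $\alpha=1/2=\ln 2/\ln 4$ is the Hausdorff dimension of the support of $\mu$. *)

theory Defs
  imports "HOL-Probability.Probability"
begin

text \<open>The count \<open>#(\<Lambda> \<inter> (x + h[-1,1]^d))\<close> is taken with respect to counting measure rather than
  \<^const>\<open>card\<close>, so that it is \<open>\<infinity>\<close> (and not 0) if the intersection is infinite.\<close>

definition upper_beurling_density :: "real \<Rightarrow> 'a::euclidean_space set \<Rightarrow> ennreal" where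
  "upper_beurling_density \<alpha> \<Lambda> =
     Limsup at_top (\<lambda>h::real. SUP x::'a.
       emeasure (count_space UNIV) (\<Lambda> \<inter> (\<lambda>y. x + h *\<^sub>R y) ` cbox (- One) One) / ennreal (h powr \<alpha>))"

definition tau :: "real \<Rightarrow> real \<Rightarrow> real" where
  "tau b x = (x + b) / 4"

definition Gamma1 :: "real set" where
  "Gamma1 = {\<Sum>j\<le>n. a j * 4 ^ j | (a :: nat \<Rightarrow> real) (n :: nat). \<forall>j\<le>n. a j \<in> {0, 1}}"

definition expo :: "real \<Rightarrow> real \<Rightarrow> complex" where
  "expo l x = exp (2 * complex_of_real pi * \<i> * complex_of_real l * complex_of_real x)"

definition L2_fun :: "'a measure \<Rightarrow> ('a \<Rightarrow> complex) set" where
  "L2_fun M = {f. f \<in> borel_measurable M \<and> integrable M (\<lambda>x. (cmod (f x))\<^sup>2)}"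

definition L2_inner :: "'a measure \<Rightarrow> ('a \<Rightarrow> complex) \<Rightarrow> ('a \<Rightarrow> complex) \<Rightarrow> complex" where
  "L2_inner M f g = (LINT x|M. f x * cnj (g x))"

definition L2_nrm :: "'a measure \<Rightarrow> ('a \<Rightarrow> complex) \<Rightarrow> real" where
  "L2_nrm M f = sqrt (LINT x|M. (cmod (f x))\<^sup>2)"

text \<open>Elements of \<open>L\<^sup>2(M)\<close> are represented by functions. Distinct members of \<open>B\<close> must be orthogonal,
  so no two of them represent the same class. The last conjunct says that the linear
  span of \<open>B\<close> is dense in \<open>L\<^sup>2(M)\<close>.\<close>

definition L2_orthonormal_basis :: "'a measure \<Rightarrow> ('a \<Rightarrow> complex) set \<Rightarrow> bool" where
  "L2_orthonormal_basis M B \<longleftrightarrow>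
     B \<subseteq> L2_fun M \<and>
     (\<forall>f\<in>B. \<forall>g\<in>B. L2_inner M f g = (if f = g then 1 else 0)) \<and>
     (\<forall>f\<in>L2_fun M. \<forall>\<epsilon>>0. \<exists>S c. finite S \<and> S \<subseteq> B \<and>
        L2_nrm M (\<lambda>x. f x - (\<Sum>g\<in>S. c g * g x)) < \<epsilon>)"

end

theory Submission
  imports Defs
begin

text \<open>
  \<^bold>\<open>Density.\<close> The elements of \<open>Gamma1\<close> with at most \<open>n\<close> base-4 digits form a set of \<open>2^n\<close> integers below
  \<open>4^n\<close>, and a window of length comparable to \<open>4^n\<close> meets boundedly many of its translates by multiples
  of \<open>4^n\<close>. A window of radius \<open>h \<ge> 1\<close> therefore contains at most \<open>6 h^(1/2)\<close> points of \<open>Gamma1\<close>, and the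
  window centred at 0 contains at least \<open>h^(1/2) / 2\<close> of them. The density scales like
  \<open>D(c \<Lambda>) = c^(-\<alpha>) D(\<Lambda>)\<close>, because the factor \<open>c\<close> only reparametrises the windows.

  \<^bold>\<open>Spectra.\<close> What remains is that \<open>p Gamma1\<close> with \<open>p = 5^k\<close> is a spectrum of \<open>\<mu>\<close> (lemma
  \<open>spectral_pair\<close>). Self-similarity gives
  \<open>|ft t|^2 = cos^2 (\<pi> t / 2) |ft (t / 4)|^2\<close> for the Fourier transform \<open>ft\<close> of \<open>\<mu>\<close>. As \<open>p\<close> is odd, \<open>ft\<close>
  vanishes at all differences of distinct elements of \<open>p Gamma1\<close>, which is orthonormality. The exponential
  of frequency \<open>-t\<close> lies in the closed span if and only if
  \<open>q t = (\<Sum>\<lambda>. |ft (t + \<lambda>)|^2)\<close>, summed over \<open>p Gamma1\<close>, equals 1. This function is Lipschitz, at most 1,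
  equal to 1 at 0, and satisfies
  \<open>q t = cos^2 (\<pi> t / 2) q (t / 4) + sin^2 (\<pi> t / 2) q ((t + p) / 4)\<close>.

  That these properties force \<open>q = 1\<close> is lemma \<open>harmonic_ge_1\<close>. Take a minimum of \<open>q\<close>, over a large compact
  interval that is stable under \<open>t \<mapsto> t / 4\<close> and \<open>t \<mapsto> (t + p) / 4\<close>; every one of these two points that is
  reached from a minimiser with nonzero weight is again a minimiser. If a minimiser \<open>t\<close> is not an
  integer, all \<open>t / 4^n\<close> are minimisers, so by continuity the minimum is \<open>q 0 = 1\<close>. If all minimisers are
  integers, there is an infinite sequence of integer minimisers with \<open>4 x(n+1) = x(n)\<close> modulo \<open>p\<close>, drawn
  towards the interval \<open>[0, p/3]\<close>. Some power \<open>4^N\<close> is \<open>-1\<close> modulo \<open>5^k\<close> (lemma \<open>five_power_dvd\<close>), so for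
  large \<open>m\<close> the number \<open>x(m) + x(m+N)\<close> is a multiple of \<open>p\<close> in \<open>[0, p)\<close>; it is 0, hence so is \<open>x(m)\<close>, and
  again the minimum is \<open>q 0 = 1\<close>.

  Hence all exponentials lie in the closed span of the spectrum. Since \<open>\<mu>\<close> has bounded support,
  trigonometric sums approximate continuous functions by Stone-Weierstrass, and these are dense in
  \<open>L\<^sup>2(\<mu>)\<close>.
\<close>

section \<open>Sums of distinct powers of four\<close>

text \<open>The integers with at most \<open>n\<close> base-4 digits, all of them 0 or 1. The recursion prepends the
  least significant digit, which matches the self-similarity of the measure.\<close>

primrec digit_sums :: "nat \<Rightarrow> nat set" where
  "digit_sums 0 = {0}"
| "digit_sums (Suc n) = (\<lambda>g. 4 * g) ` digit_sums n \<union> (\<lambda>g. 4 * g + 1) ` digit_sums n"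

lemma digit_sums_SucE:
  assumes "g \<in> digit_sums (Suc n)"
  obtains a x where "g = 4 * a + x" "a \<in> digit_sums n" "x \<in> {0, 1}"
  using assms by (auto intro: that[where x=0] that[where x=1])

lemma finite_digit_sums [simp]: "finite (digit_sums n)"
  by (induction n) auto

lemma zero_in_digit_sums [simp]: "0 \<in> digit_sums n"
  by (induction n) auto

lemma digit_sums_disjoint:
  "(\<lambda>g. 4 * g) ` A \<inter> (\<lambda>g. 4 * g + 1) ` B = ({} :: nat set)"
proof -
  have "4 * a \<noteq> 4 * b + (1::nat)" for a b by presburger
  then show ?thesis by blast
qed

lemma card_digit_sums: "card (digit_sums n) = 2 ^ n"
proof (induction n)
  case (Suc n)
  have "card ((\<lambda>g. 4 * g) ` digit_sums n) = 2 ^ n" "card ((\<lambda>g. 4 * g + 1) ` digit_sums n) = 2 ^ n"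
    using Suc by (auto simp: card_image inj_on_def)
  then show ?case
    by (simp add: card_Un_disjoint digit_sums_disjoint del: One_nat_def)
qed auto

lemma digit_sums_less: "g \<in> digit_sums n \<Longrightarrow> g < 4 ^ n"
  by (induction n arbitrary: g) force+

lemma digit_sums_Suc_mono: "digit_sums n \<subseteq> digit_sums (Suc n)"
proof (induction n)
  case (Suc n)
  show ?case
    unfolding digit_sums.simps(2)[of "Suc n"]
    by (subst digit_sums.simps(2)[of n]) (intro Un_mono image_mono Suc)
qed auto

lemma digit_sums_mono: "m \<le> n \<Longrightarrow> digit_sums m \<subseteq> digit_sums n"
  by (rule lift_Suc_mono_le[of digit_sums]) (use digit_sums_Suc_mono in auto)

lemma digit_sums_mod: "g \<in> digit_sums m \<Longrightarrow> g mod 4 ^ n \<in> digit_sums n"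
proof (induction n arbitrary: m g)
  case (Suc n)
  have "\<exists>a g' m'. g = 4 * g' + a \<and> a \<in> {0, 1} \<and> g' \<in> digit_sums m'"
  proof -
    have "g \<in> digit_sums (Suc m)" using Suc.prems digit_sums_Suc_mono by blast
    then show ?thesis by (rule digit_sums_SucE) blast
  qed
  then obtain a g' m' where g: "g = 4 * g' + a" "a \<in> {0,1}" "g' \<in> digit_sums m'" by blast
  have "g mod 4 ^ Suc n = 4 * (g' mod 4 ^ n) + a"
    using g(2) mod_mult2_eq[of g 4 "4 ^ n"] unfolding g(1) by auto
  with Suc.IH[OF g(3)] g(2) show ?case by auto
qed auto

lemma digit_expansions:
  "{\<Sum>j<n. a j * 4 ^ j | a :: nat \<Rightarrow> real. \<forall>j<n. a j \<in> {0, 1}} = real ` digit_sums n"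
proof (induction n)
  case (Suc n)
  show ?case
  proof (intro equalityI subsetI)
    fix x :: real assume "x \<in> {\<Sum>j<Suc n. a j * 4 ^ j | a. \<forall>j<Suc n. a j \<in> {0, 1}}"
    then obtain a where a: "x = (\<Sum>j<Suc n. a j * 4 ^ j)" "\<forall>j<Suc n. a j \<in> {0, 1}" by blast
    have "(\<Sum>j<n. a (Suc j) * 4 ^ j) \<in> real ` digit_sums n"
      unfolding Suc[symmetric] using a(2) by (intro CollectI exI[of _ "\<lambda>j. a (Suc j)"]) simp
    then obtain g where g: "g \<in> digit_sums n" "(\<Sum>j<n. a (Suc j) * 4 ^ j) = real g" by blast
    have "x = a 0 + 4 * (\<Sum>j<n. a (Suc j) * 4 ^ j)"
      unfolding a(1) by (subst sum.lessThan_Suc_shift) (simp add: sum_distrib_left mult_ac)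
    also have "\<dots> = a 0 + real (4 * g)" using g by simp
    finally have x: "x = a 0 + real (4 * g)" .
    have "a 0 \<in> {0, 1}" using a(2) by auto
    then show "x \<in> real ` digit_sums (Suc n)"
    proof safe
      assume "a 0 = 0"
      with x have "x = real (4 * g)" by simp
      with g(1) show ?thesis unfolding digit_sums.simps by blast
    next
      assume "a 0 = 1"
      with x have "x = real (4 * g + 1)" by simp
      with g(1) show ?thesis unfolding digit_sums.simps by blast
    qed
  next
    fix x assume "x \<in> real ` digit_sums (Suc n)"
    then obtain g c where g: "g \<in> digit_sums n" "x = c + 4 * real g" "c \<in> {0, 1}" by auto
    then have "real g \<in> {\<Sum>j<n. a j * 4 ^ j | a :: nat \<Rightarrow> real. \<forall>j<n. a j \<in> {0, 1}}"
      unfolding Suc by auto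
    then obtain a :: "nat \<Rightarrow> real" where a: "real g = (\<Sum>j<n. a j * 4 ^ j)" "\<forall>j<n. a j \<in> {0, 1}" by blast
    define b where "b = case_nat c a"
    have "x = (\<Sum>j<Suc n. b j * 4 ^ j)"
      unfolding g(2) a(1) by (subst sum.lessThan_Suc_shift) (simp add: sum_distrib_left mult_ac b_def)
    moreover have "\<forall>j<Suc n. b j \<in> {0, 1}"
      using g(3) a(2) by (auto simp: b_def split: nat.split)
    ultimately show "x \<in> {\<Sum>j<Suc n. a j * 4 ^ j | a. \<forall>j<Suc n. a j \<in> {0, 1}}" by blast
  qed
qed auto

lemma Gamma1_eq: "Gamma1 = (\<Union>n. real ` digit_sums n)"
proof -
  have "Gamma1 = (\<Union>n. {\<Sum>j<Suc n. a j * 4 ^ j | a :: nat \<Rightarrow> real. \<forall>j<Suc n. a j \<in> {0, 1}})"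
    unfolding Gamma1_def lessThan_Suc_atMost less_Suc_eq_le by blast
  also have "\<dots> = (\<Union>n. real ` digit_sums (Suc n))"
    unfolding digit_expansions ..
  also have "\<dots> = (\<Union>n. real ` digit_sums n)"
    using digit_sums_Suc_mono by blast
  finally show ?thesis .
qed

text \<open>An element of the window is determined by its residue modulo \<open>4 ^ n\<close>, for which there are
  \<open>2 ^ n\<close> possibilities, and its quotient, which lies among three consecutive integers.\<close>

lemma card_Gamma1_window:
  assumes "h \<le> 4 ^ n"
  shows "finite (Gamma1 \<inter> {x-h..x+h})" "card (Gamma1 \<inter> {x-h..x+h}) \<le> 3 * 2 ^ n"
proof -
  define u where "u = \<lfloor>(x - h) / 4 ^ n\<rfloor>"
  define v where "v = (\<lambda>(r, s). real_of_int (int r + 4 ^ n * s))"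
  have *: "Gamma1 \<inter> {x-h..x+h} \<subseteq> v ` (digit_sums n \<times> {u..u + 2})"
  proof
    fix y assume y: "y \<in> Gamma1 \<inter> {x-h..x+h}"
    then obtain g m where g: "y = real g" "g \<in> digit_sums m" by (auto simp: Gamma1_eq)
    define s where "s = int (g div 4 ^ n)"
    have s: "s = \<lfloor>y / 4 ^ n\<rfloor>"
      using floor_divide_of_nat_eq[of g "4 ^ n", where 'a=real] by (simp add: s_def g)
    have "u \<le> s"
      unfolding s u_def using y by (intro floor_mono divide_right_mono) auto
    moreover have "s \<le> u + 2"
    proof -
      have "y / 4 ^ n \<le> (x - h) / 4 ^ n + 2"
        using y assms by (simp add: field_simps)
      then have "s \<le> \<lfloor>(x - h) / 4 ^ n + 2\<rfloor>" unfolding s by (rule floor_mono)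
      then show ?thesis by (simp add: u_def)
    qed
    moreover have "y = v (g mod 4 ^ n, s)"
    proof -
      have "g = g mod 4 ^ n + 4 ^ n * (g div 4 ^ n)" by simp
      then have "int g = int (g mod 4 ^ n) + 4 ^ n * s"
        unfolding s_def by (metis of_nat_add of_nat_mult of_nat_numeral of_nat_power)
      then show ?thesis unfolding v_def g by (metis case_prod_conv of_int_of_nat_eq)
    qed
    ultimately show "y \<in> v ` (digit_sums n \<times> {u..u + 2})"
      using digit_sums_mod[OF g(2), of n] by (intro image_eqI[of _ _ "(g mod 4 ^ n, s)"]) auto
  qed
  show "finite (Gamma1 \<inter> {x-h..x+h})"
    by (rule finite_subset[OF *]) auto
  have "card (Gamma1 \<inter> {x-h..x+h}) \<le> card (v ` (digit_sums n \<times> {u..u + 2}))"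
    by (rule card_mono[OF _ *]) auto
  also have "\<dots> \<le> card (digit_sums n \<times> {u..u + 2})" by (rule card_image_le) auto
  also have "\<dots> = 3 * 2 ^ n" by (simp add: card_cartesian_product card_digit_sums)
  finally show "card (Gamma1 \<inter> {x-h..x+h}) \<le> 3 * 2 ^ n" .
qed

section \<open>Beurling density of the digit set\<close>

lemma four_power_bracket:
  fixes h :: real assumes "h \<ge> 1"
  obtains n where "4 ^ n \<le> h" "h \<le> 4 ^ Suc n"
proof -
  define n where "n = nat \<lfloor>log 4 h\<rfloor>"
  have "log 4 h \<ge> 0" using assms by simp
  then have "real n \<le> log 4 h" "log 4 h \<le> real (Suc n)" unfolding n_def by linarith+
  then have "4 powr real n \<le> h" "h \<le> 4 powr real (Suc n)"
    using assms by (auto simp: le_log_iff log_le_iff)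
  then show ?thesis by (intro that) (simp_all only: powr_realpow zero_less_numeral)
qed

lemma powr_half_4_power: "(4 ^ n :: real) powr (1/2) = 2 ^ n"
proof -
  have "(4::real) ^ n = (2 ^ n)\<^sup>2" by (simp add: power2_eq_square flip: power_mult_distrib)
  then show ?thesis by (simp add: powr_half_sqrt)
qed

lemma window_real:
  assumes "h > 0"
  shows "(\<lambda>y::real. x + h *\<^sub>R y) ` cbox (- One) One = {x-h..x+h}"
  using assms image_affinity_atLeastAtMost[of h x "-1" 1]
  by (simp add: add.commute cbox_interval)

lemma upper_beurling_density_Gamma1_le: "upper_beurling_density (1/2) Gamma1 \<le> 6"
  unfolding upper_beurling_density_def
proof (rule Limsup_bounded, rule eventually_mono[OF eventually_ge_at_top[of 1]], rule SUP_least)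
  fix h x :: real assume h: "1 \<le> h"
  then obtain n where n: "4 ^ n \<le> h" "h \<le> 4 ^ Suc n" using four_power_bracket by blast
  let ?W = "Gamma1 \<inter> {x-h..x+h}"
  have "2 ^ n \<le> h powr (1/2)"
    using powr_mono2[OF _ _ n(1), of "1/2"] by (simp add: powr_half_4_power)
  moreover have "real (card ?W) \<le> real (3 * 2 ^ Suc n)"
    using card_Gamma1_window(2)[OF n(2)] by (rule of_nat_mono)
  ultimately have "real (card ?W) / h powr (1/2) \<le> 6"
    using h by (simp add: field_simps)
  then have "ennreal (real (card ?W) / h powr (1/2)) \<le> ennreal 6" by (rule ennreal_leI)
  then show "emeasure (count_space UNIV) (Gamma1 \<inter> (\<lambda>y. x + h *\<^sub>R y) ` cbox (- One) One) /
      ennreal (h powr (1/2)) \<le> 6"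
    using h card_Gamma1_window(1)[OF n(2)]
    by (subst window_real) (simp_all add: ennreal_of_nat_eq_real_of_nat divide_ennreal)
qed

lemma upper_beurling_density_Gamma1_ge: "ennreal (1/2) \<le> upper_beurling_density (1/2) Gamma1"
  unfolding upper_beurling_density_def
proof (rule le_Limsup[OF trivial_limit_at_top_linorder], rule eventually_mono[OF eventually_ge_at_top[of 1]],
    rule SUP_upper2[of 0])
  fix h :: real assume h: "1 \<le> h"
  then obtain n where n: "4 ^ n \<le> h" "h \<le> 4 ^ Suc n" using four_power_bracket by blast
  let ?W = "Gamma1 \<inter> {0-h..0+h}"
  have "h powr (1/2) \<le> 2 ^ Suc n"
    using powr_mono2[OF _ _ n(2), of "1/2"] h unfolding powr_half_4_power by simp
  moreover have "2 ^ n \<le> card ?W"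
  proof -
    have "real ` digit_sums n \<subseteq> ?W"
    proof
      fix y assume "y \<in> real ` digit_sums n"
      then obtain g where g: "g \<in> digit_sums n" "y = real g" by blast
      then have "y \<le> real (4 ^ n)" using digit_sums_less[OF g(1)] by (metis less_imp_le of_nat_le_iff)
      then have "y \<le> h" using n(1) by simp
      with g n h show "y \<in> ?W" by (auto simp: Gamma1_eq)
    qed
    then have "card (real ` digit_sums n) \<le> card ?W"
      by (intro card_mono card_Gamma1_window(1)[OF n(2)])
    then show ?thesis by (simp add: card_image inj_on_def card_digit_sums)
  qed
  then have "2 ^ n \<le> real (card ?W)" by (metis of_nat_le_iff of_nat_numeral of_nat_power)
  then have "2 ^ Suc n \<le> 2 * real (card ?W)" unfolding power_Suc by (rule mult_left_mono) simp
  ultimately have "h powr (1/2) \<le> 2 * real (card ?W)" by (rule order_trans)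
  then have "1/2 \<le> real (card ?W) / h powr (1/2)"
    using h by (simp add: field_simps)
  then have "ennreal (1/2) \<le> ennreal (real (card ?W) / h powr (1/2))" by (rule ennreal_leI)
  then show "ennreal (1/2) \<le> emeasure (count_space UNIV) (Gamma1 \<inter> (\<lambda>y. 0 + h *\<^sub>R y) ` cbox (- One) One) /
      ennreal (h powr (1/2))"
    using h card_Gamma1_window(1)[OF n(2), of 0]
    by (subst window_real) (simp_all add: ennreal_of_nat_eq_real_of_nat divide_ennreal)
qed simp

lemma upper_beurling_density_scale:
  fixes \<Lambda> :: "real set"
  assumes c: "c > 0"
  shows "upper_beurling_density \<alpha> ((\<lambda>x. c * x) ` \<Lambda>) = ennreal (1 / c powr \<alpha>) * upper_beurling_density \<alpha> \<Lambda>"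
proof -
  define N where "N L h x = emeasure (count_space UNIV) (L \<inter> {x-h..x+h})" for L :: "real set" and h x
  define F where "F L h = (SUP x. N L h x / ennreal (h powr \<alpha>))" for L :: "real set" and h
  have density: "upper_beurling_density \<alpha> L = Limsup at_top (F L)" for L :: "real set"
    unfolding upper_beurling_density_def
    by (rule Limsup_eq, rule eventually_mono[OF eventually_gt_at_top[of 0]])
       (subst window_real, simp_all add: F_def N_def)
  have N: "N ((\<lambda>x. c * x) ` \<Lambda>) h x = N \<Lambda> (h / c) (x / c)" for h x
  proof -
    have "(\<lambda>x. c * x) ` \<Lambda> \<inter> {x-h..x+h} = (\<lambda>x. c * x) ` (\<Lambda> \<inter> {x/c-h/c..x/c+h/c})"
      using c by (auto simp: field_simps)
    then show ?thesis
      unfolding N_def using c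
      by (simp add: emeasure_count_space finite_image_iff card_image inj_on_def)
  qed
  have F: "F ((\<lambda>x. c * x) ` \<Lambda>) h = ennreal (1 / c powr \<alpha>) * F \<Lambda> (h / c)" if h: "h > 0" for h
  proof -
    have "F ((\<lambda>x. c * x) ` \<Lambda>) h = (SUP x. N \<Lambda> (h / c) (x / c) / ennreal (h powr \<alpha>))"
      by (simp add: F_def N)
    also have "\<dots> = (SUP y\<in>range (\<lambda>x. x / c). N \<Lambda> (h / c) y / ennreal (h powr \<alpha>))"
      by (simp add: image_image)
    also have "range (\<lambda>x. x / c) = UNIV"
      using c by (intro surjI[of _ "\<lambda>x. c * x"]) simp
    also have "(SUP y. N \<Lambda> (h / c) y / ennreal (h powr \<alpha>)) =
        (SUP y. ennreal (1 / c powr \<alpha>) * (N \<Lambda> (h / c) y / ennreal ((h / c) powr \<alpha>)))"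
    proof -
      have "inverse (ennreal (h powr \<alpha>)) = ennreal (1 / c powr \<alpha>) * inverse (ennreal ((h / c) powr \<alpha>))"
        using h c by (simp add: inverse_ennreal powr_divide field_simps flip: ennreal_mult)
      then show ?thesis by (simp add: divide_ennreal_def mult_ac)
    qed
    also have "\<dots> = ennreal (1 / c powr \<alpha>) * F \<Lambda> (h / c)"
      by (simp add: F_def SUP_mult_left_ennreal)
    finally show ?thesis .
  qed
  have "upper_beurling_density \<alpha> ((\<lambda>x. c * x) ` \<Lambda>) =
      Limsup at_top (\<lambda>h. ennreal (1 / c powr \<alpha>) * F \<Lambda> (h / c))"
    unfolding density by (rule Limsup_eq, rule eventually_mono[OF eventually_gt_at_top[of 0]]) (rule F)
  also have "\<dots> = Limsup (filtermap (\<lambda>h. h * (1 / c)) at_top) (\<lambda>h. ennreal (1 / c powr \<alpha>) * F \<Lambda> h)"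
    using c by (simp add: Limsup_filtermap_eq inj_on_def)
  also have "filtermap (\<lambda>h. h * (1 / c)) at_top = at_top"
  proof (rule filtermap_fun_inverse[of "\<lambda>h. h * c"])
    show "LIM h at_top. h * (1 / c) :> at_top" "LIM h at_top. h * c :> at_top"
      using c by (intro filterlim_at_top_mult_tendsto_pos[OF tendsto_const] filterlim_ident; simp)+
  qed (use c in auto)
  also have "Limsup at_top (\<lambda>h. ennreal (1 / c powr \<alpha>) * F \<Lambda> h) = ennreal (1 / c powr \<alpha>) * Limsup at_top (F \<Lambda>)"
    using c by (intro Limsup_compose_continuous_mono[of "\<lambda>x. ennreal (1 / c powr \<alpha>) * x"])
       (auto intro!: tendsto_mult_ennreal mult_left_mono simp: mono_def continuous_on_def)
  finally show ?thesis by (simp add: density)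
qed

section \<open>Exponentials\<close>

lemma cmod_add_one_cis: "(cmod ((1 + cis \<theta>) / 2))\<^sup>2 = (cos (\<theta> / 2))\<^sup>2"
proof -
  have "(cmod ((1 + cis \<theta>) / 2))\<^sup>2 = ((1 + cos \<theta>)\<^sup>2 + (sin \<theta>)\<^sup>2) / 4"
    by (simp add: norm_divide power_divide cmod_power2)
  also have "\<dots> = (1 + cos \<theta>) / 2"
    unfolding sin_squared_eq by (simp add: power2_eq_square field_simps)
  also have "\<dots> = (cos (\<theta> / 2))\<^sup>2"
    using cos_double_cos[of "\<theta> / 2"] by simp
  finally show ?thesis .
qed

lemma cmod_cis_diff_le: "cmod (cis a - cis b) \<le> \<bar>a - b\<bar>"
proof -
  have "cis a - cis b = cis b * (cis (a - b) - 1)"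
    by (simp add: algebra_simps cis_mult)
  then have "cmod (cis a - cis b) = cmod (cis (a - b) - 1)"
    by (simp add: norm_mult)
  also have "\<dots> = 2 * \<bar>sin ((a - b) / 2)\<bar>"
    unfolding cis_conv_exp by (rule dist_exp_i_1)
  also have "\<dots> \<le> \<bar>a - b\<bar>"
    using abs_sin_x_le_abs_x[of "(a - b) / 2"] by simp
  finally show ?thesis .
qed

lemma abs_cos_diff_le: "\<bar>cos a - cos b\<bar> \<le> \<bar>a - b :: real\<bar>"
  using abs_Re_le_cmod[of "cis a - cis b"] cmod_cis_diff_le[of a b] by simp

lemma expo_cis: "expo t x = cis (2 * pi * t * x)"
  by (simp add: expo_def cis_conv_exp mult_ac)

lemma cmod_expo [simp]: "cmod (expo t x) = 1"
  by (simp add: expo_cis)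

lemma expo_0 [simp]: "expo 0 x = 1"
  by (simp add: expo_cis)

lemma expo_mult: "expo s x * expo t x = expo (s + t) x"
  by (simp add: expo_cis cis_mult algebra_simps)

lemma cnj_expo [simp]: "cnj (expo t x) = expo (- t) x"
  by (simp add: expo_cis cis_cnj)

lemma continuous_on_expo [continuous_intros]: "continuous_on A (expo t)"
  unfolding expo_def by (intro continuous_intros)

lemma borel_measurable_expo [measurable]: "expo t \<in> borel_measurable borel"
  by (intro borel_measurable_continuous_onI continuous_intros)

section \<open>A minimum principle\<close>

lemma five_power_dvd: "\<exists>N. int (5 ^ k) dvd 4 ^ N + 1"
proof (cases k)
  case (Suc j)
  have "(5::int) ^ Suc j dvd 4 ^ (5 ^ j) + 1"
  proof (induction j)
    case (Suc j)
    define y :: int where "y = 4 ^ (5 ^ j)"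
    have y: "5 ^ Suc j dvd y + 1" using Suc by (simp add: y_def)
    then have "5 dvd y + 1" by (meson dvd_trans dvd_triv_left power_Suc dvd_power zero_less_Suc)
    then obtain z where z: "y + 1 = 5 * z" by (elim dvdE)
    \<comment> \<open>Writing \<open>y ^ 5 + 1\<close> as \<open>(y + 1)\<close> times a quartic, the quartic is 5 modulo \<open>y + 1\<close>.\<close>
    have "y ^ 4 - y ^ 3 + y ^ 2 - y + 1 = 5 + (y + 1) * (y ^ 3 - 2 * y ^ 2 + 3 * y - 4)"
      by algebra
    also have "\<dots> = 5 * (1 + z * (y ^ 3 - 2 * y ^ 2 + 3 * y - 4))"
      unfolding z by algebra
    finally have "5 dvd y ^ 4 - y ^ 3 + y ^ 2 - y + 1" by (rule dvdI)
    with y have "5 ^ Suc j * 5 dvd (y + 1) * (y ^ 4 - y ^ 3 + y ^ 2 - y + 1)" by (rule mult_dvd_mono)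
    also have "(y + 1) * (y ^ 4 - y ^ 3 + y ^ 2 - y + 1) = y ^ 5 + 1" by algebra
    also have "y ^ 5 = 4 ^ (5 ^ Suc j)" by (simp add: y_def mult.commute flip: power_mult)
    finally show ?case by (simp add: mult_ac)
  qed auto
  then show ?thesis unfolding Suc by auto
qed auto

lemma cos_half_pi_eq_0:
  assumes "cos (pi * x / 2) = 0"
  shows "x \<in> \<int>"
proof -
  obtain i where "odd i" "pi * x / 2 = of_int i * (pi / 2)"
    using assms cos_zero_iff_int[of "pi * x / 2"] by blast
  then have "x = of_int i" by simp
  then show ?thesis by simp
qed

text \<open>The minimum principle for the averaging operator with weights \<open>cos\<^sup>2\<close> and \<open>sin\<^sup>2\<close>. The
  divisibility hypothesis rules out integer cycles of minimisers other than \<open>{0}\<close>.\<close>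

lemma harmonic_ge_1:
  fixes q :: "real \<Rightarrow> real" and p N :: nat
  assumes p: "p > 0" and dvd: "int p dvd 4 ^ N + 1"
    and cont: "continuous_on UNIV q" and q0: "q 0 = 1"
    and q: "\<And>t. q t = (cos (pi * t / 2))\<^sup>2 * q (t / 4) + (sin (pi * t / 2))\<^sup>2 * q ((t + p) / 4)"
  shows "q t \<ge> 1"
proof (rule ccontr)
  assume t: "\<not> q t \<ge> 1"
  define M where "M = max \<bar>t\<bar> (real p)"
  define J where "J = {-M..M}"
  have M: "real p \<le> M" "0 < M" using p by (auto simp: M_def)
  have "compact J" "J \<noteq> {}" "continuous_on J q"
    using M by (auto simp: J_def intro: continuous_on_subset[OF cont])
  then obtain t0 where t0: "t0 \<in> J" "\<And>s. s \<in> J \<Longrightarrow> q t0 \<le> q s"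
    using continuous_attains_inf[of J q] by blast
  define c where "c = q t0"
  have c: "\<And>s. s \<in> J \<Longrightarrow> c \<le> q s" using t0 by (simp add: c_def)
  have "t \<in> J" unfolding J_def M_def by auto
  then have c_less: "c < 1" using c[of t] t by linarith
  have J4: "s / 4 \<in> J" "(s + p) / 4 \<in> J" if "s \<in> J" for s
    using that M by (auto simp: J_def)
  have child: "(cos (pi * s / 2) \<noteq> 0 \<longrightarrow> q (s / 4) = c) \<and> (sin (pi * s / 2) \<noteq> 0 \<longrightarrow> q ((s + p) / 4) = c)"
    if s: "s \<in> J" "q s = c" for s
  proof -
    define C S u v where defs: "C = (cos (pi * s / 2))\<^sup>2" "S = (sin (pi * s / 2))\<^sup>2" "u = q (s / 4) - c" "v = q ((s + p) / 4) - c"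
    have CS: "C + S = 1" "C \<ge> 0" "S \<ge> 0" by (auto simp: defs)
    have uv: "u \<ge> 0" "v \<ge> 0" using c J4[OF s(1)] by (auto simp: defs)
    have "c = C * (u + c) + S * (v + c)" using q[of s] s(2) by (simp add: defs)
    also have "\<dots> = C * u + S * v + (C + S) * c" by (simp add: algebra_simps)
    finally have "C * u + S * v = 0" using CS by simp
    then have "C * u = 0" "S * v = 0"
      using CS uv add_nonneg_eq_0_iff[of "C * u" "S * v"] by auto
    then show ?thesis by (auto simp: defs)
  qed
  have int: "s \<in> \<int>" if s: "s \<in> J" "q s = c" for s
  proof (rule ccontr)
    assume nint: "s \<notin> \<int>"
    have "s / 4 ^ n \<in> J \<and> q (s / 4 ^ n) = c" for n
    proof (induction n)
      case (Suc n)
      have "cos (pi * (s / 4 ^ n) / 2) \<noteq> 0"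
      proof
        assume "cos (pi * (s / 4 ^ n) / 2) = 0"
        then have "s / 4 ^ n \<in> \<int>" by (rule cos_half_pi_eq_0)
        then have "s / 4 ^ n * 4 ^ n \<in> \<int>" by (intro Ints_mult Ints_power) auto
        with nint show False by simp
      qed
      then have "q (s / 4 ^ n / 4) = c" using child Suc by blast
      moreover have "s / 4 ^ n / 4 \<in> J" using Suc J4 by blast
      ultimately show ?case by (simp add: mult.commute)
    qed (use s in auto)
    then have "(\<lambda>n. q (s / 4 ^ n)) \<longlonglongrightarrow> c" by simp
    moreover have "(\<lambda>n. q (s / 4 ^ n)) \<longlonglongrightarrow> q 0"
    proof (rule continuous_on_tendsto_compose[OF cont])
      have "(\<lambda>n. s * (1 / 4) ^ n) \<longlonglongrightarrow> s * 0" by (intro tendsto_intros) auto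
      then show "(\<lambda>n. s / 4 ^ n) \<longlonglongrightarrow> 0" by (simp add: power_one_over)
    qed auto
    ultimately have "q 0 = c" using LIMSEQ_unique by blast
    with q0 c_less show False by simp
  qed
  \<comment> \<open>From here on all minimisers in \<open>J\<close> are integers, and each has an integer successor.\<close>
  define K where "K = {i::int. real_of_int i \<in> J \<and> q i = c}"
  have "\<exists>i'\<in>K. 4 * i' = i \<or> 4 * i' = i + int p" if "i \<in> K" for i
  proof -
    have i: "real_of_int i \<in> J" "q i = c" using that by (auto simp: K_def)
    have "cos (pi * i / 2) \<noteq> 0 \<or> sin (pi * i / 2) \<noteq> 0"
      by (metis sin_cos_squared_add power_zero_numeral add_0 zero_neq_one)
    then have "\<exists>s. s \<in> J \<and> q s = c \<and> (s = i / 4 \<or> s = (i + p) / 4)"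
      using child[OF i] J4[OF i(1)] by auto
    then obtain s where s: "s \<in> J" "q s = c" "s = i / 4 \<or> s = (i + p) / 4" by auto
    obtain i' where i': "s = real_of_int i'" using int[OF s(1,2)] by (elim Ints_cases)
    then have "real_of_int (4 * i') = real_of_int i \<or> real_of_int (4 * i') = real_of_int (i + int p)"
      using s(3) by auto
    then have "4 * i' = i \<or> 4 * i' = i + int p" unfolding of_int_eq_iff .
    then show ?thesis using s i' by (auto simp: K_def)
  qed
  then obtain f where f: "\<And>i. i \<in> K \<Longrightarrow> f i \<in> K \<and> (4 * f i = i \<or> 4 * f i = i + int p)"
    by metis
  obtain i0 where "i0 \<in> K" using int[OF t0(1)] t0(1) by (auto simp: c_def K_def elim!: Ints_cases)
  define x where "x n = (f ^^ n) i0" for n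
  have xK: "x n \<in> K" for n
    by (induction n) (use \<open>i0 \<in> K\<close> f in \<open>auto simp: x_def\<close>)
  have x_Suc: "4 * x (Suc n) = x n \<or> 4 * x (Suc n) = x n + int p" for n
    using f[OF xK[of n]] by (simp add: x_def)
  define r where "r n = M / 4 ^ n" for n
  have bound: "- r n \<le> x n \<and> x n \<le> p / 3 + r n" for n
  proof (induction n)
    case 0
    have "real_of_int (x 0) \<in> J" using xK[of 0] by (simp add: K_def)
    then show ?case by (simp add: J_def r_def add_increasing)
  next
    case (Suc n)
    have "4 * real_of_int (x (Suc n)) = x n \<or> 4 * real_of_int (x (Suc n)) = x n + p"
      using x_Suc[of n] by (metis of_int_add of_int_mult of_int_numeral of_int_of_nat_eq)
    then have "real_of_int (x n) \<le> 4 * real_of_int (x (Suc n))"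
      "4 * real_of_int (x (Suc n)) \<le> real_of_int (x n) + p" by auto
    moreover have "r (Suc n) = r n / 4" by (simp add: r_def)
    ultimately show ?case using Suc by linarith
  qed
  have cong: "int p dvd 4 ^ n * x (m + n) - x m" for m n
  proof (induction n)
    case (Suc n)
    have "int p dvd 4 * x (Suc (m + n)) - x (m + n)" using x_Suc[of "m + n"] by (elim disjE) simp_all
    then have "int p dvd 4 ^ n * (4 * x (Suc (m + n)) - x (m + n)) + (4 ^ n * x (m + n) - x m)"
      using Suc by (intro dvd_add dvd_mult)
    then show ?case by (simp add: algebra_simps)
  qed auto
  obtain m where m: "r m < 1 / 8"
  proof -
    have "(\<lambda>n. M * (1 / 4) ^ n) \<longlonglongrightarrow> M * 0" by (intro tendsto_intros) auto
    then have "eventually (\<lambda>n. M * (1 / 4) ^ n < 1 / 8) sequentially"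
      by (intro order_tendstoD) auto
    then show ?thesis using that by (auto simp: eventually_sequentially r_def power_one_over)
  qed
  have m': "r (m + N) < 1 / 8"
  proof -
    have "r (m + N) \<le> r m"
      unfolding r_def using M by (intro divide_left_mono power_increasing) auto
    with m show ?thesis by simp
  qed
  have lower: "x m \<ge> 0" "x (m + N) \<ge> 0"
    using bound[of m] bound[of "m + N"] m m' by linarith+
  have "real_of_int (x m + x (m + N)) < real p"
    using bound[of m] bound[of "m + N"] m m' p by simp
  then have less: "x m + x (m + N) < int p" by linarith
  have "int p dvd (4 ^ N + 1) * x (m + N) - (4 ^ N * x (m + N) - x m)"
    by (rule dvd_diff[OF dvd_mult2[OF dvd] cong])
  then have "int p dvd x m + x (m + N)" by (simp add: algebra_simps)
  then have "x m + x (m + N) = 0"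
    using less lower zdvd_not_zless[of "x m + x (m + N)" "int p"] by fastforce
  then have "x m = 0" using lower by linarith
  then have "q 0 = c" using xK[of m] by (simp add: K_def)
  with q0 c_less show False by simp
qed

section \<open>The measure and its Fourier transform\<close>

text \<open>The self-similar probability measure with \<open>\<mu> = (\<mu> \<circ> \<tau>\<^sub>0\<^sup>-\<^sup>1 + \<mu> \<circ> \<tau>\<^sub>2\<^sup>-\<^sup>1) / 2\<close>.\<close>

locale quarter_cantor_measure = prob_space \<mu> for \<mu> :: "real measure" +
  assumes sets_mu: "sets \<mu> = sets borel"
    and self_similar: "\<forall>A\<in>sets borel. measure \<mu> A =
           1 / 2 * (measure (distr \<mu> borel (tau 0)) A + measure (distr \<mu> borel (tau 2)) A)"
begin

lemma measurable_mu [simp]: "borel_measurable \<mu> = borel_measurable borel"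
  by (rule measurable_cong_sets[OF sets_mu refl])

lemma space_mu [simp]: "space \<mu> = UNIV"
  using sets_eq_imp_space_eq[OF sets_mu] by simp

lemma prob_UNIV [simp]: "prob UNIV = 1"
  using prob_space by simp

lemma measurable_tau [measurable]: "tau b \<in> borel_measurable borel"
  unfolding tau_def by measurable

lemma prob_self_similar:
  assumes "A \<in> sets borel"
  shows "prob A = (prob (tau 0 -` A) + prob (tau 2 -` A)) / 2"
  using self_similar assms by (simp add: measure_distr)

text \<open>The support lies in \<open>[0, 2/3]\<close>, but any bounded interval is enough. A point outside
  \<open>[-(1+s), 1+s]\<close> comes under both maps from outside \<open>[-(1+4s), 1+4s]\<close>, so that the tail at \<open>1+1\<close> is
  bounded by the tails at \<open>1+4^n\<close>.\<close>

lemma AE_support: "AE x in \<mu>. \<bar>x\<bar> \<le> 2"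
proof -
  define T where "T s = {x::real. \<bar>x\<bar> > 1 + s}" for s :: real
  have T [measurable]: "T s \<in> sets borel" for s unfolding T_def by measurable
  have vimage: "tau b -` T s \<subseteq> T (4 * s)" if "b \<in> {0, 2}" for b s
    using that by (auto simp: tau_def T_def abs_if field_simps split: if_splits)
  have vT: "tau b -` T s \<in> sets borel" for b s
    using measurable_sets[OF measurable_tau T, of b s] by simp
  have step: "prob (T s) \<le> prob (T (4 * s))" for s
  proof -
    have "prob (tau b -` T s) \<le> prob (T (4 * s))" if "b \<in> {0, 2}" for b
      using vimage[OF that] by (intro finite_measure_mono) (auto simp: sets_mu)
    from this[of 0] this[of 2] show ?thesis
      by (simp add: prob_self_similar)
  qed
  have "prob (T 1) \<le> prob (T (4 ^ n))" for n
    by (induction n) (use step order_trans in \<open>auto\<close>)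
  moreover have "(\<lambda>n. prob (T (4 ^ n))) \<longlonglongrightarrow> prob (\<Inter>n. T (4 ^ n))"
  proof (rule finite_Lim_measure_decseq)
    show "decseq (\<lambda>n. T (4 ^ n))"
    proof (rule decseq_SucI)
      fix n :: nat
      have "(4::real) ^ n \<le> 4 ^ Suc n" by (intro power_increasing) auto
      then show "T (4 ^ Suc n) \<subseteq> T (4 ^ n)" unfolding T_def by (intro Collect_mono impI) linarith
    qed
  qed (auto simp: sets_mu)
  moreover have "(\<Inter>n. T (4 ^ n)) = {}"
  proof -
    have "x \<notin> (\<Inter>n. T (4 ^ n))" for x
    proof -
      obtain n where "\<bar>x\<bar> < 4 ^ n" using real_arch_pow[of 4 "\<bar>x\<bar>"] by auto
      then have "x \<notin> T (4 ^ n)" by (simp add: T_def)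
      then show ?thesis by blast
    qed
    then show ?thesis by blast
  qed
  ultimately have "prob (T 1) \<le> prob {}"
    by (intro LIMSEQ_le_const[of "\<lambda>n. prob (T (4 ^ n))"]) auto
  then have "prob (T 1) = 0" by (simp add: measure_le_0_iff)
  then have "AE x in \<mu>. x \<notin> T 1"
    by (subst (asm) prob_eq_0) (auto simp: sets_mu)
  then show ?thesis by eventually_elim (auto simp: T_def)
qed

lemma integrable_bounded:
  fixes f :: "real \<Rightarrow> complex"
  assumes "f \<in> borel_measurable borel" "\<And>x. cmod (f x) \<le> C"
  shows "integrable \<mu> f"
  using assms by (intro integrable_const_bound[of _ C]) auto

text \<open>The measure is regarded as a two-step experiment: choose \<open>b\<close> uniformly in \<open>{0, 2}\<close>, then a point
  from the image of \<open>\<mu>\<close> under \<open>tau b\<close>. Integrals against it are then iterated integrals.\<close>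

lemma real_integral_self_similar:
  fixes f :: "real \<Rightarrow> real"
  assumes f [measurable]: "f \<in> borel_measurable borel" and bounded: "\<And>x. \<bar>f x\<bar> \<le> C"
  shows "(LINT x|\<mu>. f x) = ((LINT x|\<mu>. f (x / 4)) + (LINT x|\<mu>. f ((x + 2) / 4))) / 2"
proof -
  define D where "D = pmf_of_set {0, 2::real}"
  define K where "K b = distr \<mu> borel (tau b)" for b
  have K: "prob_space (K b)" for b
    unfolding K_def by (rule prob_space_distr) simp
  have K_sub: "subprob_space (K b)" for b by (rule prob_space_imp_subprob_space[OF K])
  have K_meas: "K \<in> measurable D (subprob_algebra borel)"
    using K_sub by (auto simp: space_subprob_algebra K_def)
  have "\<mu> = measure_pmf D \<bind> K"
  proof (rule measure_eqI)
    show "sets \<mu> = sets (measure_pmf D \<bind> K)"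
      by (simp add: sets_mu sets_bind[OF sets_kernel[OF K_meas]])
    fix A assume "A \<in> sets \<mu>"
    then have A: "A \<in> sets borel" by (simp add: sets_mu)
    have "emeasure (measure_pmf D \<bind> K) A = (\<integral>\<^sup>+b. emeasure (K b) A \<partial>D)"
      using A by (intro emeasure_bind[OF _ K_meas]) auto
    also have "\<dots> = (\<integral>\<^sup>+b. ennreal (measure (K b) A) \<partial>D)"
      by (simp add: finite_measure.emeasure_eq_measure[OF prob_space.finite_measure[OF K]])
    also have "\<dots> = ennreal (1 / 2 * (measure (K 0) A + measure (K 2) A))"
      by (simp add: D_def nn_integral_pmf_of_set flip: ennreal_plus divide_ennreal ennreal_numeral)
    finally show "emeasure \<mu> A = emeasure (measure_pmf D \<bind> K) A"
      using self_similar A by (simp add: emeasure_eq_measure K_def)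
  qed
  then have "(LINT x|\<mu>. f x) = (LINT x|(measure_pmf D \<bind> K). f x)" by simp
  also have "\<dots> = (LINT b|D. LINT x|K b. f x)"
    using K bounded
    by (intro integral_bind[OF f _ K_meas, where B=C and B'=1])
       (auto simp: measure_pmf.finite_measure prob_space.emeasure_space_1)
  also have "\<dots> = ((LINT x|K 0. f x) + (LINT x|K 2. f x)) / 2"
    by (simp add: D_def integral_pmf_of_set)
  also have "\<dots> = ((LINT x|\<mu>. f (x / 4)) + (LINT x|\<mu>. f ((x + 2) / 4))) / 2"
    unfolding K_def by (subst (1 2) integral_distr) (auto simp: tau_def)
  finally show ?thesis .
qed

lemma integral_self_similar:
  fixes f :: "real \<Rightarrow> complex"
  assumes f [measurable]: "f \<in> borel_measurable borel" and bounded: "\<And>x. cmod (f x) \<le> C"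
  shows "(LINT x|\<mu>. f x) = ((LINT x|\<mu>. f (x / 4)) + (LINT x|\<mu>. f ((x + 2) / 4))) / 2"
proof -
  have int: "integrable \<mu> (\<lambda>x. f (h x))" if "h \<in> borel_measurable borel" for h
    using that by (intro integrable_bounded[of _ C] bounded) measurable
  note ints = int[of "\<lambda>x. x"] int[of "\<lambda>x. x / 4"] int[of "\<lambda>x. (x + 2) / 4"]
  show ?thesis
  proof (rule complex_eqI)
    show "Re (LINT x|\<mu>. f x) = Re (((LINT x|\<mu>. f (x / 4)) + (LINT x|\<mu>. f ((x + 2) / 4))) / 2)"
      using real_integral_self_similar[of "\<lambda>x. Re (f x)" C] ints
        order_trans[OF abs_Re_le_cmod bounded] by simp
    show "Im (LINT x|\<mu>. f x) = Im (((LINT x|\<mu>. f (x / 4)) + (LINT x|\<mu>. f ((x + 2) / 4))) / 2)"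
      using real_integral_self_similar[of "\<lambda>x. Im (f x)" C] ints
        order_trans[OF abs_Im_le_cmod bounded] by simp
  qed
qed

text \<open>The Fourier transform of \<open>\<mu>\<close>, with the sign and the \<open>2\<pi>\<close> of \<open>expo\<close>.\<close>

definition ft :: "real \<Rightarrow> complex" where
  "ft t = (LINT x|\<mu>. expo t x)"

text \<open>The squared modulus of the Fourier transform.\<close>

definition ft_sq :: "real \<Rightarrow> real" where
  "ft_sq t = (cmod (ft t))\<^sup>2"

lemma integrable_expo [simp]: "integrable \<mu> (expo t)"
  by (rule integrable_bounded[of _ 1]) auto

lemma ft_0: "ft 0 = 1"
  by (simp add: ft_def prob_space)

lemma cmod_ft_le: "cmod (ft t) \<le> 1"
proof -
  have "cmod (ft t) \<le> (LINT x|\<mu>. cmod (expo t x))"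
    unfolding ft_def by (rule integral_norm_bound)
  then show ?thesis by (simp add: prob_space)
qed

lemma ft_scale: "ft t = (1 + cis (pi * t)) / 2 * ft (t / 4)"
proof -
  have "ft t = ((LINT x|\<mu>. expo t (x / 4)) + (LINT x|\<mu>. expo t ((x + 2) / 4))) / 2"
    unfolding ft_def by (rule integral_self_similar[of _ 1]) auto
  moreover have "(\<lambda>x. expo t (x / 4)) = expo (t / 4)"
    by (simp add: expo_cis fun_eq_iff mult_ac)
  moreover have "(\<lambda>x. expo t ((x + 2) / 4)) = (\<lambda>x. cis (pi * t) * expo (t / 4) x)"
    by (simp add: expo_cis fun_eq_iff cis_mult algebra_simps add_divide_distrib)
  ultimately have "ft t = (ft (t / 4) + cis (pi * t) * ft (t / 4)) / 2"
    by (simp only: ft_def) simp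
  then show ?thesis by (simp add: algebra_simps)
qed

lemma ft_sq_scale: "ft_sq t = (cos (pi * t / 2))\<^sup>2 * ft_sq (t / 4)"
  unfolding ft_sq_def
  by (subst ft_scale) (simp only: norm_mult power_mult_distrib cmod_add_one_cis)

lemma ft_sq_0: "ft_sq 0 = 1"
  by (simp add: ft_sq_def ft_0)

lemma ft_sq_nonneg: "0 \<le> ft_sq t"
  by (simp add: ft_sq_def)

lemma ft_sq_le_1: "ft_sq t \<le> 1"
  using cmod_ft_le by (simp add: ft_sq_def power_le_one)

lemma ft_minus: "ft (- t) = cnj (ft t)"
  unfolding ft_def using Bochner_Integration.integral_cnj[of \<mu> "expo t"] by simp

lemma ft_sq_minus: "ft_sq (- t) = ft_sq t"
  by (simp add: ft_sq_def ft_minus)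

lemma ft_Lipschitz: "cmod (ft t - ft s) \<le> 4 * pi * \<bar>t - s\<bar>"
proof -
  have "ft t - ft s = (LINT x|\<mu>. expo t x - expo s x)" by (simp add: ft_def)
  also have "cmod \<dots> \<le> (LINT x|\<mu>. cmod (expo t x - expo s x))"
    by (rule integral_norm_bound)
  also have "\<dots> \<le> (LINT x|\<mu>. 4 * pi * \<bar>t - s\<bar>)"
  proof (rule integral_mono_AE)
    show "AE x in \<mu>. cmod (expo t x - expo s x) \<le> 4 * pi * \<bar>t - s\<bar>"
      using AE_support
    proof eventually_elim
      fix x :: real assume x: "\<bar>x\<bar> \<le> 2"
      have "cmod (expo t x - expo s x) \<le> \<bar>2 * pi * (t - s) * x\<bar>"
        using cmod_cis_diff_le[of "2 * pi * t * x" "2 * pi * s * x"] by (simp add: expo_cis algebra_simps)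
      also have "\<dots> = 2 * pi * \<bar>t - s\<bar> * \<bar>x\<bar>" by (simp add: abs_mult)
      also have "\<dots> \<le> 2 * pi * \<bar>t - s\<bar> * 2" using x by (intro mult_left_mono) auto
      finally show "cmod (expo t x - expo s x) \<le> 4 * pi * \<bar>t - s\<bar>" by simp
    qed
  qed auto
  also have "\<dots> = 4 * pi * \<bar>t - s\<bar>" by (simp add: prob_space)
  finally show ?thesis .
qed

lemma ft_sq_Lipschitz: "\<bar>ft_sq t - ft_sq s\<bar> \<le> 8 * pi * \<bar>t - s\<bar>"
proof -
  have "\<bar>ft_sq t - ft_sq s\<bar> = \<bar>cmod (ft t) - cmod (ft s)\<bar> * (cmod (ft t) + cmod (ft s))"
    unfolding ft_sq_def by (simp add: power2_eq_square square_diff_square_factored abs_mult mult.commute)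
  also have "\<dots> \<le> (4 * pi * \<bar>t - s\<bar>) * 2"
    using cmod_ft_le[of t] cmod_ft_le[of s] order_trans[OF norm_triangle_ineq3 ft_Lipschitz[of t s]]
    by (intro mult_mono) auto
  finally show ?thesis by simp
qed

section \<open>The energy captured by a spectrum\<close>

text \<open>The squared norm of the projection of \<open>expo (- t)\<close> to the span of the exponentials with
  frequencies in \<open>p\<close> times the \<open>n\<close>-digit sums, when these exponentials are orthonormal.\<close>

definition energy :: "nat \<Rightarrow> nat \<Rightarrow> real \<Rightarrow> real" where
  "energy p n t = (\<Sum>g\<in>digit_sums n. ft_sq (t + real p * real g))"

lemma cos_sin_odd_shift:
  assumes "odd p"
  shows "(cos (pi * (t + real p) / 2))\<^sup>2 = (sin (pi * t / 2))\<^sup>2"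
proof -
  obtain j where "p = 2 * j + 1" using assms by (elim oddE)
  then have *: "pi * (t + real p) / 2 = (pi * t / 2 + pi / 2) + real j * pi"
    by (simp add: field_simps)
  have "cos (pi * (t + real p) / 2) = cos (pi * t / 2 + pi / 2) * (- 1) ^ j"
    unfolding * by (subst cos_add) simp
  then show ?thesis by (simp add: power_mult_distrib cos_add flip: power_mult)
qed

lemma cos_even_shift: "(cos (pi * (t + 4 * real m) / 2))\<^sup>2 = (cos (pi * t / 2))\<^sup>2"
proof -
  have "pi * (t + 4 * real m) / 2 = pi * t / 2 + real (2 * m) * pi"
    by (simp add: field_simps)
  then have "cos (pi * (t + 4 * real m) / 2) = cos (pi * t / 2) * (- 1) ^ (2 * m)"
    by (simp only: cos_add cos_npi sin_npi)
  then show ?thesis by simp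
qed

lemma energy_Suc:
  assumes "odd p"
  shows "energy p (Suc n) t =
    (cos (pi * t / 2))\<^sup>2 * energy p n (t / 4) + (sin (pi * t / 2))\<^sup>2 * energy p n ((t + real p) / 4)"
proof -
  have *: "(\<Sum>g\<in>digit_sums n. ft_sq (t + real p * real (4 * g))) = (cos (pi * t / 2))\<^sup>2 * energy p n (t / 4)" for t
  proof -
    have "ft_sq (t + real p * real (4 * g)) = (cos (pi * t / 2))\<^sup>2 * ft_sq (t / 4 + real p * real g)" for g
      using ft_sq_scale[of "t + 4 * real (p * g)"] unfolding cos_even_shift
      by (simp add: add_divide_distrib mult_ac)
    then show ?thesis by (simp add: energy_def sum_distrib_left)
  qed
  have "energy p (Suc n) t = (\<Sum>g\<in>digit_sums n. ft_sq (t + real p * real (4 * g))) +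
      (\<Sum>g\<in>digit_sums n. ft_sq ((t + real p) + real p * real (4 * g)))"
    unfolding energy_def digit_sums.simps
    by (subst sum.union_disjoint)
       (simp_all only: digit_sums_disjoint finite_imageI finite_digit_sums,
        simp add: sum.reindex inj_on_def algebra_simps)
  then show ?thesis by (simp only: * cos_sin_odd_shift[OF assms])
qed

lemma energy_nonneg: "0 \<le> energy p n t"
  unfolding energy_def by (intro sum_nonneg ft_sq_nonneg)

lemma energy_le_1:
  assumes "odd p"
  shows "energy p n t \<le> 1"
proof (induction n arbitrary: t)
  case (Suc n)
  have "energy p (Suc n) t \<le> (cos (pi * t / 2))\<^sup>2 * 1 + (sin (pi * t / 2))\<^sup>2 * 1"
    unfolding energy_Suc[OF assms] by (intro add_mono mult_left_mono Suc) auto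
  then show ?case by simp
qed (simp add: energy_def ft_sq_le_1)

text \<open>The constant does not depend on \<open>n\<close>: by the recursion, a Lipschitz constant \<open>L\<close> becomes at most
  \<open>L / 4 + \<pi> / 2\<close>.\<close>

lemma energy_Lipschitz:
  assumes "odd p"
  shows "\<bar>energy p n t - energy p n s\<bar> \<le> 8 * pi * \<bar>t - s\<bar>"
proof (induction n arbitrary: t s)
  case (Suc n)
  define C where "C u = (cos (pi * u / 2))\<^sup>2" for u :: real
  define E where "E = energy p n"
  have C: "0 \<le> C u" "C u \<le> 1" for u
    by (auto simp: C_def power_le_one abs_square_le_1)
  have E: "energy p (Suc n) u = C u * E (u / 4) + (1 - C u) * E ((u + p) / 4)" for u
    unfolding energy_Suc[OF assms] C_def E_def by (simp add: sin_squared_eq)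
  have dC: "\<bar>C t - C s\<bar> \<le> pi / 2 * \<bar>t - s\<bar>"
  proof -
    have "C u = (1 + cos (pi * u)) / 2" for u
      using cos_double_cos[of "pi * u / 2"] by (simp add: C_def)
    then have "C t - C s = (cos (pi * t) - cos (pi * s)) / 2"
      by (simp only: diff_divide_distrib add_divide_distrib)
    then have "\<bar>C t - C s\<bar> = \<bar>(cos (pi * t) - cos (pi * s)) / 2\<bar>" by (rule arg_cong)
    also have "\<dots> = \<bar>cos (pi * t) - cos (pi * s)\<bar> / 2" by (simp only: abs_divide abs_numeral)
    also have "\<dots> \<le> \<bar>pi * t - pi * s\<bar> / 2" by (simp add: abs_cos_diff_le)
    also have "\<dots> = pi / 2 * \<bar>t - s\<bar>" by (simp add: abs_mult flip: right_diff_distrib)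
    finally show ?thesis .
  qed
  have dE: "\<bar>E (t / 4) - E (s / 4)\<bar> \<le> 2 * pi * \<bar>t - s\<bar>" "\<bar>E ((t + p) / 4) - E ((s + p) / 4)\<bar> \<le> 2 * pi * \<bar>t - s\<bar>"
    using Suc[of "t / 4" "s / 4"] Suc[of "(t + p) / 4" "(s + p) / 4"]
    by (simp_all add: E_def flip: diff_divide_distrib)
  have E01: "\<bar>E (s / 4) - E ((s + p) / 4)\<bar> \<le> 1"
    using energy_nonneg[of p n "s / 4"] energy_nonneg[of p n "(s + p) / 4"]
      energy_le_1[OF assms, of n "s / 4"] energy_le_1[OF assms, of n "(s + p) / 4"] by (simp add: E_def)
  have "energy p (Suc n) t - energy p (Suc n) s =
      C t * (E (t / 4) - E (s / 4)) + (1 - C t) * (E ((t + p) / 4) - E ((s + p) / 4)) +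
      (C t - C s) * (E (s / 4) - E ((s + p) / 4))"
    unfolding E by (simp add: algebra_simps)
  also have "\<bar>\<dots>\<bar> \<le> C t * \<bar>E (t / 4) - E (s / 4)\<bar> + (1 - C t) * \<bar>E ((t + p) / 4) - E ((s + p) / 4)\<bar> +
      \<bar>C t - C s\<bar> * \<bar>E (s / 4) - E ((s + p) / 4)\<bar>"
    using C[of t] by (intro order_trans[OF abs_triangle_ineq] add_mono) (simp_all add: abs_mult)
  also have "\<dots> \<le> C t * (2 * pi * \<bar>t - s\<bar>) + (1 - C t) * (2 * pi * \<bar>t - s\<bar>) + (pi / 2 * \<bar>t - s\<bar>) * 1"
    using C[of t] dE dC E01 by (intro add_mono mult_mono mult_left_mono) auto
  also have "\<dots> = 5 / 2 * pi * \<bar>t - s\<bar>" by (simp add: algebra_simps)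
  also have "\<dots> \<le> 8 * pi * \<bar>t - s\<bar>" by (intro mult_right_mono) auto
  finally show ?case .
qed (use ft_sq_Lipschitz in \<open>simp add: energy_def\<close>)

lemma energy_mono: "m \<le> n \<Longrightarrow> energy p m t \<le> energy p n t"
  unfolding energy_def by (intro sum_mono2 digit_sums_mono ft_sq_nonneg) auto

lemma energy_tendsto_1:
  assumes "odd p" and dvd: "int p dvd 4 ^ N + 1"
  shows "(\<lambda>n. energy p n t) \<longlonglongrightarrow> 1"
proof -
  define q where "q t = lim (\<lambda>n. energy p n t)" for t
  have q: "(\<lambda>n. energy p n t) \<longlonglongrightarrow> q t" for t
  proof -
    have "incseq (\<lambda>n. energy p n t)" "\<forall>n. energy p n t \<le> 1"
      using energy_mono energy_le_1[OF \<open>odd p\<close>] by (auto simp: incseq_def)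
    then obtain L where "(\<lambda>n. energy p n t) \<longlonglongrightarrow> L"
      by (rule incseq_convergent)
    then show ?thesis unfolding q_def by (simp add: limI)
  qed
  have q_le: "q t \<le> 1" for t
    by (rule LIMSEQ_le_const2[OF q]) (use energy_le_1[OF \<open>odd p\<close>] in auto)
  have "q t \<ge> 1"
  proof (rule harmonic_ge_1[where q = q, OF _ dvd])
    show "p > 0" using \<open>odd p\<close> by (rule odd_pos)
    have "(8 * pi)-lipschitz_on UNIV q"
    proof (rule lipschitz_onI)
      show "dist (q t) (q s) \<le> 8 * pi * dist t s" for t s
        unfolding dist_real_def
        by (rule LIMSEQ_le_const2[OF tendsto_rabs[OF tendsto_diff[OF q q]]])
           (use energy_Lipschitz[OF \<open>odd p\<close>] in auto)
    qed auto
    then show "continuous_on UNIV q" by (rule lipschitz_on_continuous_on)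
    have "energy p 0 0 \<le> q 0"
      by (rule LIMSEQ_le_const[OF q]) (use energy_mono in auto)
    then show "q 0 = 1" using q_le[of 0] by (simp add: energy_def ft_sq_0)
    show "q t = (cos (pi * t / 2))\<^sup>2 * q (t / 4) + (sin (pi * t / 2))\<^sup>2 * q ((t + p) / 4)" for t
    proof (rule LIMSEQ_unique)
      show "(\<lambda>n. energy p (Suc n) t) \<longlonglongrightarrow> q t" by (rule LIMSEQ_Suc[OF q])
      show "(\<lambda>n. energy p (Suc n) t) \<longlonglongrightarrow> (cos (pi * t / 2))\<^sup>2 * q (t / 4) + (sin (pi * t / 2))\<^sup>2 * q ((t + p) / 4)"
        unfolding energy_Suc[OF \<open>odd p\<close>] by (intro tendsto_intros q)
    qed
  qed
  with q_le[of t] q[of t] show ?thesis by simp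
qed

text \<open>After cancelling equal low digits the difference is odd, where the factor \<open>cos\<^sup>2\<close> of \<open>ft_sq_scale\<close>
  vanishes.\<close>

lemma ft_sq_digit_diff:
  assumes "odd p" "g \<in> digit_sums n" "h \<in> digit_sums n" "g \<noteq> h"
  shows "ft_sq (real p * (real g - real h)) = 0"
  using assms(2-4)
proof (induction n arbitrary: g h)
  case (Suc n)
  obtain a x where g: "g = 4 * a + x" "a \<in> digit_sums n" "x \<in> {0, 1}"
    using Suc.prems(1) by (rule digit_sums_SucE)
  obtain b y where h: "h = 4 * b + y" "b \<in> digit_sums n" "y \<in> {0, 1}"
    using Suc.prems(2) by (rule digit_sums_SucE)
  show ?case
  proof (cases "x = y")
    case True
    then have "ft_sq (real p * (real a - real b)) = 0"
      using Suc.IH g h Suc.prems(3) by blast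
    moreover have "real p * (real g - real h) / 4 = real p * (real a - real b)"
      using g h True by simp
    ultimately show ?thesis by (subst ft_sq_scale) (simp only: mult_zero_right)
  next
    case False
    have "odd (int g - int h)" using g h False by auto
    then have "odd (int p * (int g - int h))" using \<open>odd p\<close> by simp
    then have "cos (pi * real_of_int (int p * (int g - int h)) / 2) = 0"
      unfolding cos_zero_iff_int by (intro exI[of _ "int p * (int g - int h)"]) simp
    then show ?thesis by (subst ft_sq_scale) simp
  qed
qed auto

end

section \<open>Closed spans in \<open>L\<^sup>2\<close>\<close>

text \<open>The closed linear span of \<open>B\<close> in \<open>L\<^sup>2(M)\<close>, as a set of functions. Distances are measured by the
  squared norm: closure properties then follow from \<open>cmod_add_squared_le\<close> without the triangle
  inequality of the norm.\<close>

definition L2_closure :: "'a measure \<Rightarrow> ('a \<Rightarrow> complex) set \<Rightarrow> ('a \<Rightarrow> complex) set" where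
  "L2_closure M B = {f \<in> L2_fun M. \<forall>\<epsilon>>0. \<exists>S c. finite S \<and> S \<subseteq> B \<and>
     (LINT x|M. (cmod (f x - (\<Sum>g\<in>S. c g * g x)))\<^sup>2) < \<epsilon>}"

lemma cmod_add_squared_le: "(cmod (a + b))\<^sup>2 \<le> 2 * (cmod a)\<^sup>2 + 2 * (cmod b)\<^sup>2"
proof -
  have "(cmod (a + b))\<^sup>2 \<le> (cmod a + cmod b)\<^sup>2"
    by (intro power_mono norm_triangle_ineq norm_ge_zero)
  also have "\<dots> \<le> 2 * (cmod a)\<^sup>2 + 2 * (cmod b)\<^sup>2"
    using sum_squares_bound[of "cmod a" "cmod b"] by (simp add: power2_sum)
  finally show ?thesis .
qed

lemma L2_fun_add:
  assumes "f \<in> L2_fun M" "g \<in> L2_fun M"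
  shows "(\<lambda>x. f x + g x) \<in> L2_fun M"
proof -
  have [measurable]: "f \<in> borel_measurable M" "g \<in> borel_measurable M"
    and int: "integrable M (\<lambda>x. 2 * (cmod (f x))\<^sup>2 + 2 * (cmod (g x))\<^sup>2)"
    using assms by (auto simp: L2_fun_def)
  have "integrable M (\<lambda>x. (cmod (f x + g x))\<^sup>2)"
    by (rule Bochner_Integration.integrable_bound[OF int]) (auto intro!: cmod_add_squared_le)
  then show ?thesis by (simp add: L2_fun_def)
qed

lemma L2_fun_cmult:
  assumes "f \<in> L2_fun M"
  shows "(\<lambda>x. c * f x) \<in> L2_fun M"
  using assms by (auto simp: L2_fun_def norm_mult power_mult_distrib)

lemma L2_fun_diff:
  assumes "f \<in> L2_fun M" "g \<in> L2_fun M"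
  shows "(\<lambda>x. f x - g x) \<in> L2_fun M"
  using L2_fun_add[OF assms(1) L2_fun_cmult[OF assms(2), of "-1"]] by simp

lemma L2_fun_sum:
  assumes "finite S" "S \<subseteq> L2_fun M"
  shows "(\<lambda>x. \<Sum>g\<in>S. c g * g x) \<in> L2_fun M"
  using assms
proof (induction S rule: finite_induct)
  case (insert g S)
  then show ?case by (simp add: L2_fun_add L2_fun_cmult)
qed (simp add: L2_fun_def)

lemma L2_square_add_le:
  assumes "f \<in> L2_fun M" "g \<in> L2_fun M"
  shows "(LINT x|M. (cmod (f x + g x))\<^sup>2) \<le> 2 * (LINT x|M. (cmod (f x))\<^sup>2) + 2 * (LINT x|M. (cmod (g x))\<^sup>2)"
proof -
  have "(LINT x|M. (cmod (f x + g x))\<^sup>2) \<le> (LINT x|M. 2 * (cmod (f x))\<^sup>2 + 2 * (cmod (g x))\<^sup>2)"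
    using assms L2_fun_add[OF assms]
    by (intro integral_mono cmod_add_squared_le) (auto simp: L2_fun_def)
  also have "\<dots> = 2 * (LINT x|M. (cmod (f x))\<^sup>2) + 2 * (LINT x|M. (cmod (g x))\<^sup>2)"
    using assms by (simp add: L2_fun_def)
  finally show ?thesis .
qed

lemma L2_closureI:
  assumes "f \<in> L2_fun M"
    and "\<And>\<epsilon>. \<epsilon> > 0 \<Longrightarrow> \<exists>S c. finite S \<and> S \<subseteq> B \<and> (LINT x|M. (cmod (f x - (\<Sum>g\<in>S. c g * g x)))\<^sup>2) < \<epsilon>"
  shows "f \<in> L2_closure M B"
  using assms by (simp add: L2_closure_def)

lemma L2_closureD:
  assumes "f \<in> L2_closure M B" "\<epsilon> > 0"
  obtains S c where "finite S" "S \<subseteq> B" "(LINT x|M. (cmod (f x - (\<Sum>g\<in>S. c g * g x)))\<^sup>2) < \<epsilon>"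
  using assms unfolding L2_closure_def by blast

lemma L2_closure_subset: "L2_closure M B \<subseteq> L2_fun M"
  by (auto simp: L2_closure_def)

lemma L2_closure_cmult:
  assumes "f \<in> L2_closure M B"
  shows "(\<lambda>x. a * f x) \<in> L2_closure M B"
proof (rule L2_closureI)
  show "(\<lambda>x. a * f x) \<in> L2_fun M"
    using assms L2_closure_subset L2_fun_cmult by blast
  fix \<epsilon> :: real assume \<epsilon>: "\<epsilon> > 0"
  define \<delta> where "\<delta> = \<epsilon> / ((cmod a)\<^sup>2 + 1)"
  have pos: "(cmod a)\<^sup>2 + 1 > 0" by (simp add: add_nonneg_pos)
  then have "\<delta> > 0" using \<epsilon> by (simp add: \<delta>_def)
  then obtain S c where S: "finite S" "S \<subseteq> B" "(LINT x|M. (cmod (f x - (\<Sum>g\<in>S. c g * g x)))\<^sup>2) < \<delta>"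
    using L2_closureD[OF assms] by blast
  have "(cmod (a * f x - (\<Sum>g\<in>S. a * c g * g x)))\<^sup>2 = (cmod a)\<^sup>2 * (cmod (f x - (\<Sum>g\<in>S. c g * g x)))\<^sup>2" for x
    unfolding power_mult_distrib[symmetric] norm_mult[symmetric]
    by (simp add: right_diff_distrib sum_distrib_left mult.assoc)
  then have "(LINT x|M. (cmod (a * f x - (\<Sum>g\<in>S. a * c g * g x)))\<^sup>2) =
      (cmod a)\<^sup>2 * (LINT x|M. (cmod (f x - (\<Sum>g\<in>S. c g * g x)))\<^sup>2)" by simp
  also have "\<dots> \<le> (cmod a)\<^sup>2 * \<delta>"
    using S(3) by (intro mult_left_mono) auto
  also have "\<dots> < ((cmod a)\<^sup>2 + 1) * \<delta>" using \<open>\<delta> > 0\<close> by simp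
  also have "\<dots> = \<epsilon>" using pos by (simp add: \<delta>_def)
  finally show "\<exists>S c. finite S \<and> S \<subseteq> B \<and> (LINT x|M. (cmod (a * f x - (\<Sum>g\<in>S. c g * g x)))\<^sup>2) < \<epsilon>"
    using S by (intro exI[of _ S] exI[of _ "\<lambda>g. a * c g"]) simp
qed

lemma L2_closure_add:
  assumes B: "B \<subseteq> L2_fun M" and f: "f \<in> L2_closure M B" and h: "h \<in> L2_closure M B"
  shows "(\<lambda>x. f x + h x) \<in> L2_closure M B"
proof (rule L2_closureI)
  have L2: "f \<in> L2_fun M" "h \<in> L2_fun M"
    using f h L2_closure_subset by auto
  then show "(\<lambda>x. f x + h x) \<in> L2_fun M" by (rule L2_fun_add)
  fix \<epsilon> :: real assume "\<epsilon> > 0"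
  then have \<epsilon>: "\<epsilon> / 4 > 0" by simp
  obtain S c where S: "finite S" "S \<subseteq> B" "(LINT x|M. (cmod (f x - (\<Sum>g\<in>S. c g * g x)))\<^sup>2) < \<epsilon> / 4"
    using L2_closureD[OF f \<epsilon>] by blast
  obtain T d where T: "finite T" "T \<subseteq> B" "(LINT x|M. (cmod (h x - (\<Sum>g\<in>T. d g * g x)))\<^sup>2) < \<epsilon> / 4"
    using L2_closureD[OF h \<epsilon>] by blast
  define e where "e g = (if g \<in> S then c g else 0) + (if g \<in> T then d g else 0)" for g
  have sum_e: "(\<Sum>g\<in>S \<union> T. e g * g x) = (\<Sum>g\<in>S. c g * g x) + (\<Sum>g\<in>T. d g * g x)" for x
  proof -
    have "(\<Sum>g\<in>S \<union> T. (if g \<in> S then c g else 0) * g x) = (\<Sum>g\<in>S. c g * g x)"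
      using S T by (intro sum.mono_neutral_cong_right) auto
    moreover have "(\<Sum>g\<in>S \<union> T. (if g \<in> T then d g else 0) * g x) = (\<Sum>g\<in>T. d g * g x)"
      using S T by (intro sum.mono_neutral_cong_right) auto
    ultimately show ?thesis by (simp add: e_def distrib_right sum.distrib)
  qed
  have "f x + h x - (\<Sum>g\<in>S \<union> T. e g * g x) =
      (f x - (\<Sum>g\<in>S. c g * g x)) + (h x - (\<Sum>g\<in>T. d g * g x))" for x
    unfolding sum_e by simp
  then have "(LINT x|M. (cmod (f x + h x - (\<Sum>g\<in>S \<union> T. e g * g x)))\<^sup>2) =
      (LINT x|M. (cmod ((f x - (\<Sum>g\<in>S. c g * g x)) + (h x - (\<Sum>g\<in>T. d g * g x))))\<^sup>2)"
    by (simp only:)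
  also have "\<dots> \<le> 2 * (LINT x|M. (cmod (f x - (\<Sum>g\<in>S. c g * g x)))\<^sup>2) +
      2 * (LINT x|M. (cmod (h x - (\<Sum>g\<in>T. d g * g x)))\<^sup>2)"
    using S T B L2 by (intro L2_square_add_le L2_fun_diff L2_fun_sum) auto
  also have "\<dots> < \<epsilon>" using S(3) T(3) by simp
  finally show "\<exists>S c. finite S \<and> S \<subseteq> B \<and> (LINT x|M. (cmod (f x + h x - (\<Sum>g\<in>S. c g * g x)))\<^sup>2) < \<epsilon>"
    using S T by (intro exI[of _ "S \<union> T"] exI[of _ e]) simp
qed

lemma L2_closure_sum:
  assumes B: "B \<subseteq> L2_fun M" and "finite I" "\<And>i. i \<in> I \<Longrightarrow> F i \<in> L2_closure M B"
  shows "(\<lambda>x. \<Sum>i\<in>I. F i x) \<in> L2_closure M B"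
  using assms(2,3)
proof (induction I rule: finite_induct)
  case empty
  show ?case by (rule L2_closureI) (auto simp: L2_fun_def intro!: exI[of _ "{}"])
qed (simp add: L2_closure_add[OF B])

lemma L2_closure_approx:
  assumes B: "B \<subseteq> L2_fun M" and f: "f \<in> L2_fun M"
    and approx: "\<And>\<epsilon>. \<epsilon> > 0 \<Longrightarrow> \<exists>h\<in>L2_closure M B. (LINT x|M. (cmod (f x - h x))\<^sup>2) < \<epsilon>"
  shows "f \<in> L2_closure M B"
proof (rule L2_closureI[OF f])
  fix \<epsilon> :: real assume "\<epsilon> > 0"
  then have \<epsilon>: "\<epsilon> / 4 > 0" by simp
  then obtain h where h: "h \<in> L2_closure M B" "(LINT x|M. (cmod (f x - h x))\<^sup>2) < \<epsilon> / 4"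
    using approx by blast
  obtain S c where S: "finite S" "S \<subseteq> B" "(LINT x|M. (cmod (h x - (\<Sum>g\<in>S. c g * g x)))\<^sup>2) < \<epsilon> / 4"
    using L2_closureD[OF h(1) \<epsilon>] by blast
  have "(LINT x|M. (cmod (f x - (\<Sum>g\<in>S. c g * g x)))\<^sup>2) =
      (LINT x|M. (cmod ((f x - h x) + (h x - (\<Sum>g\<in>S. c g * g x))))\<^sup>2)" by simp
  also have "\<dots> \<le> 2 * (LINT x|M. (cmod (f x - h x))\<^sup>2) +
      2 * (LINT x|M. (cmod (h x - (\<Sum>g\<in>S. c g * g x)))\<^sup>2)"
    using S B f h L2_closure_subset by (intro L2_square_add_le L2_fun_diff L2_fun_sum) blast+
  also have "\<dots> < \<epsilon>" using S(3) h(2) by simp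
  finally show "\<exists>S c. finite S \<and> S \<subseteq> B \<and> (LINT x|M. (cmod (f x - (\<Sum>g\<in>S. c g * g x)))\<^sup>2) < \<epsilon>"
    using S by blast
qed

lemma L2_closure_dominated:
  assumes B: "B \<subseteq> L2_fun M" and s: "\<And>i::nat. s i \<in> L2_closure M B"
    and f [measurable]: "f \<in> borel_measurable M"
    and lim: "\<And>x. x \<in> space M \<Longrightarrow> (\<lambda>i. s i x) \<longlonglongrightarrow> f x"
    and bound: "\<And>i x. x \<in> space M \<Longrightarrow> cmod (s i x) \<le> w x"
    and w: "integrable M (\<lambda>x. (w x)\<^sup>2)"
  shows "f \<in> L2_closure M B"
proof (rule L2_closure_approx[OF B])
  have [measurable]: "s i \<in> borel_measurable M" for i
    using s[of i] by (auto simp: L2_closure_def L2_fun_def)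
  have f_le: "cmod (f x) \<le> w x" if "x \<in> space M" for x
    by (rule LIMSEQ_le_const2[OF tendsto_norm[OF lim[OF that]]]) (use bound[OF that] in auto)
  have w0: "0 \<le> w x" if "x \<in> space M" for x
    using f_le[OF that] norm_ge_zero[of "f x"] by linarith
  have "integrable M (\<lambda>x. (cmod (f x))\<^sup>2)"
    by (rule Bochner_Integration.integrable_bound[OF w]) (auto intro!: AE_I2 power_mono f_le)
  then show "f \<in> L2_fun M" by (simp add: L2_fun_def)
  have "(\<lambda>i. LINT x|M. (cmod (f x - s i x))\<^sup>2) \<longlonglongrightarrow> (LINT x|M. 0)"
  proof (rule integral_dominated_convergence[where w = "\<lambda>x. 4 * (w x)\<^sup>2"])
    show "integrable M (\<lambda>x. 4 * (w x)\<^sup>2)" using w by simp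
    show "AE x in M. (\<lambda>i. (cmod (f x - s i x))\<^sup>2) \<longlonglongrightarrow> 0"
    proof (rule AE_I2)
      fix x assume "x \<in> space M"
      from lim[OF this] have "(\<lambda>i. (cmod (f x - s i x))\<^sup>2) \<longlonglongrightarrow> (cmod (f x - f x))\<^sup>2"
        by (intro tendsto_intros)
      then show "(\<lambda>i. (cmod (f x - s i x))\<^sup>2) \<longlonglongrightarrow> 0" by simp
    qed
    show "AE x in M. norm ((cmod (f x - s i x))\<^sup>2) \<le> 4 * (w x)\<^sup>2" for i
    proof (rule AE_I2)
      fix x assume x: "x \<in> space M"
      have "(cmod (f x - s i x))\<^sup>2 \<le> (w x + w x)\<^sup>2"
        using norm_triangle_ineq4[of "f x" "s i x"] f_le[OF x] bound[OF x, of i]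
        by (intro power_mono) auto
      then show "norm ((cmod (f x - s i x))\<^sup>2) \<le> 4 * (w x)\<^sup>2" by (simp add: power2_eq_square)
    qed
  qed auto
  then have lim0: "(\<lambda>i. LINT x|M. (cmod (f x - s i x))\<^sup>2) \<longlonglongrightarrow> 0" by simp
  fix \<epsilon> :: real assume "\<epsilon> > 0"
  then have "eventually (\<lambda>i. (LINT x|M. (cmod (f x - s i x))\<^sup>2) < \<epsilon>) sequentially"
    by (rule order_tendstoD(2)[OF lim0])
  then obtain i where "(LINT x|M. (cmod (f x - s i x))\<^sup>2) < \<epsilon>"
    by (auto simp: eventually_sequentially)
  then show "\<exists>h\<in>L2_closure M B. (LINT x|M. (cmod (f x - h x))\<^sup>2) < \<epsilon>" using s by blast
qed

section \<open>Density of trigonometric sums\<close>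

text \<open>The linear span of the exponentials. It is generated inductively, so that closure under products
  needs no double sums.\<close>

inductive_set trig :: "(real \<Rightarrow> complex) set" where
  expo: "expo t \<in> trig"
| add: "f \<in> trig \<Longrightarrow> g \<in> trig \<Longrightarrow> (\<lambda>x. f x + g x) \<in> trig"
| cmult: "f \<in> trig \<Longrightarrow> (\<lambda>x. c * f x) \<in> trig"

lemma trig_expo_mult: "g \<in> trig \<Longrightarrow> (\<lambda>x. expo t x * g x) \<in> trig"
proof (induction rule: trig.induct)
  case (expo s)
  then show ?case using trig.expo[of "t + s"] by (simp add: expo_mult)
next
  case (add f g)
  then show ?case using trig.add by (simp add: distrib_left)
next
  case (cmult f c)
  then show ?case using trig.cmult[of "\<lambda>x. expo t x * f x" c] by (simp add: mult_ac)
qed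

lemma trig_mult: "f \<in> trig \<Longrightarrow> g \<in> trig \<Longrightarrow> (\<lambda>x. f x * g x) \<in> trig"
proof (induction rule: trig.induct)
  case (expo t)
  then show ?case by (rule trig_expo_mult)
next
  case (add f h)
  then show ?case using trig.add by (simp add: distrib_right)
next
  case (cmult f c)
  then show ?case using trig.cmult[of "\<lambda>x. f x * g x" c] by (simp add: mult_ac)
qed

lemma continuous_on_trig: "f \<in> trig \<Longrightarrow> continuous_on A f"
  by (induction rule: trig.induct) (auto intro!: continuous_intros)

lemma trig_const: "(\<lambda>x. c) \<in> trig"
  using trig.cmult[OF trig.expo[of 0], of c] by simp

lemma trig_sin: "(\<lambda>x. complex_of_real (sin (2 * pi * t * x))) \<in> trig"
proof -
  have "complex_of_real (sin (2 * pi * t * x)) = (- \<i> / 2) * expo t x + (\<i> / 2) * expo (- t) x" for x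
    by (simp add: complex_eq_iff expo_cis)
  then show ?thesis by (simp only:) (intro trig.intros)
qed

lemma trig_dense:
  fixes g :: "real \<Rightarrow> real"
  assumes "continuous_on {-2..2} g" "e > 0"
  obtains h where "(\<lambda>x. complex_of_real (h x)) \<in> trig" "\<And>x. \<bar>x\<bar> \<le> 2 \<Longrightarrow> \<bar>g x - h x\<bar> < e"
proof -
  have "\<exists>h. (\<lambda>x. complex_of_real (h x)) \<in> trig \<and> (\<forall>x\<in>{-2..2}. \<bar>g x - h x\<bar> < e)"
  proof (rule Stone_Weierstrass_HOL[where P = "\<lambda>h. (\<lambda>x. complex_of_real (h x)) \<in> trig", OF _ _ _ _ _ _ assms])
    show "compact {-2..2::real}" by simp
    show "(\<lambda>x. complex_of_real c) \<in> trig" for c by (rule trig_const)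
  next
    fix f g :: "real \<Rightarrow> real"
    assume "(\<lambda>x. complex_of_real (f x)) \<in> trig \<and> (\<lambda>x. complex_of_real (g x)) \<in> trig"
    then show "(\<lambda>x. complex_of_real (f x + g x)) \<in> trig" "(\<lambda>x. complex_of_real (f x * g x)) \<in> trig"
      using trig.add trig_mult by auto
  next
    fix f :: "real \<Rightarrow> real" assume "(\<lambda>x. complex_of_real (f x)) \<in> trig"
    from continuous_on_Re[OF continuous_on_trig[OF this]] show "continuous_on {-2..2} f" by simp
  next
    fix x y :: real assume xy: "x \<in> {-2..2} \<and> y \<in> {-2..2} \<and> x \<noteq> y"
    \<comment> \<open>The frequency 1/8 makes the argument of the sine stay in \<open>[-\<pi>/2, \<pi>/2]\<close>.\<close>
    define s where "s x = sin (2 * pi * (1 / 8) * x)" for x :: real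
    have "s x \<noteq> s y"
    proof
      have range: "- (pi / 2) \<le> 2 * pi * (1 / 8) * z" "2 * pi * (1 / 8) * z \<le> pi / 2"
        if "z \<in> {-2..2}" for z
      proof -
        have "pi * - 2 \<le> pi * z" "pi * z \<le> pi * 2"
          using that by (intro mult_left_mono; simp)+
        then show "- (pi / 2) \<le> 2 * pi * (1 / 8) * z" "2 * pi * (1 / 8) * z \<le> pi / 2"
          by simp_all
      qed
      assume eq: "s x = s y"
      have "2 * pi * (1 / 8) * x = 2 * pi * (1 / 8) * y"
        by (rule sin_inj_pi[OF range(1) range(2) range(1) range(2) eq[unfolded s_def]]) (use xy in auto)
      with xy show False by simp
    qed
    moreover have "(\<lambda>x. complex_of_real (s x)) \<in> trig"
      unfolding s_def by (rule trig_sin)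
    ultimately show "\<exists>f. (\<lambda>x. complex_of_real (f x)) \<in> trig \<and> f x \<noteq> f y"
      by (intro exI[of _ s] conjI)
  qed
  then show ?thesis using that by (auto simp: abs_le_iff)
qed

context quarter_cantor_measure
begin

lemma bounded_L2_fun:
  assumes "f \<in> borel_measurable borel" "\<And>x. cmod (f x) \<le> C"
  shows "f \<in> L2_fun \<mu>"
proof -
  have "integrable \<mu> (\<lambda>x. (cmod (f x))\<^sup>2)"
    using assms by (intro integrable_const_bound[of _ "C\<^sup>2"]) (auto intro!: AE_I2 power_mono)
  then show ?thesis using assms by (simp add: L2_fun_def)
qed

lemma expo_L2_fun: "expo t \<in> L2_fun \<mu>"
  by (rule bounded_L2_fun[of _ 1]) auto

text \<open>Once the closed span of \<open>B\<close> contains all exponentials, it contains in turn trigonometric sums,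
  bounded continuous functions, indicators of half-lines, indicators of Borel sets, simple functions,
  and all of \<open>L\<^sup>2(\<mu>)\<close>.\<close>

lemma L2_fun_subset_closure:
  assumes B: "B \<subseteq> L2_fun \<mu>" and expo: "\<And>t. expo t \<in> L2_closure \<mu> B"
  shows "L2_fun \<mu> \<subseteq> L2_closure \<mu> B"
proof -
  let ?V = "L2_closure \<mu> B"
  have trig: "f \<in> trig \<Longrightarrow> f \<in> ?V" for f
    by (induction rule: trig.induct) (auto intro: expo L2_closure_add[OF B] L2_closure_cmult)
  have continuous: "(\<lambda>x. complex_of_real (g x)) \<in> ?V"
    if g: "continuous_on UNIV g" "\<And>x. \<bar>g x\<bar> \<le> C" for g :: "real \<Rightarrow> real" and C
  proof (rule L2_closure_approx[OF B])
    have [measurable]: "g \<in> borel_measurable borel" using g by (intro borel_measurable_continuous_onI)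
    show "(\<lambda>x. complex_of_real (g x)) \<in> L2_fun \<mu>"
      by (rule bounded_L2_fun[of _ C]) (auto simp: g(2))
    fix \<epsilon> :: real assume \<epsilon>: "\<epsilon> > 0"
    define e where "e = sqrt (\<epsilon> / 2)"
    have e: "e > 0" "e\<^sup>2 < \<epsilon>" using \<epsilon> by (auto simp: e_def)
    obtain h where h: "(\<lambda>x. complex_of_real (h x)) \<in> trig" "\<And>x. \<bar>x\<bar> \<le> 2 \<Longrightarrow> \<bar>g x - h x\<bar> < e"
      using trig_dense[OF continuous_on_subset[OF g(1)] e(1)] by auto
    have "(LINT x|\<mu>. (cmod (complex_of_real (g x) - complex_of_real (h x)))\<^sup>2) \<le> (LINT x|\<mu>. e\<^sup>2)"
    proof (rule integral_mono_AE')
      show "AE x in \<mu>. (cmod (complex_of_real (g x) - complex_of_real (h x)))\<^sup>2 \<le> e\<^sup>2"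
        using AE_support
      proof eventually_elim
        fix x :: real assume "\<bar>x\<bar> \<le> 2"
        from h(2)[OF this] show "(cmod (complex_of_real (g x) - complex_of_real (h x)))\<^sup>2 \<le> e\<^sup>2"
          unfolding of_real_diff[symmetric] norm_of_real by (intro power_mono) auto
      qed
    qed auto
    also have "\<dots> < \<epsilon>" using e by simp
    finally show "\<exists>h\<in>?V. (LINT x|\<mu>. (cmod (complex_of_real (g x) - h x))\<^sup>2) < \<epsilon>"
      using trig[OF h(1)] by (intro bexI[of _ "\<lambda>x. complex_of_real (h x)"])
  qed
  have atMost: "indicator {..a} \<in> ?V" for a :: real
  proof (rule L2_closure_dominated[OF B, where w = "\<lambda>x. 1"])
    \<comment> \<open>Ramps that fall from 1 to 0 on \<open>[a, a + 1/n]\<close>.\<close>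
    define s where "s n x = max 0 (min 1 (1 - real n * (x - a)))" for n and x :: real
    show "(\<lambda>x. complex_of_real (s n x)) \<in> ?V" for n
      by (rule continuous[of _ 1]) (auto simp: s_def intro!: continuous_intros)
    show "(\<lambda>n. complex_of_real (s n x)) \<longlonglongrightarrow> indicator {..a} x" for x
    proof (rule tendsto_eventually)
      show "eventually (\<lambda>n. complex_of_real (s n x) = indicator {..a} x) sequentially"
      proof (cases "x \<le> a")
        case True
        then have "real n * (x - a) \<le> 0" for n by (simp add: mult_nonneg_nonpos)
        then have "s n x = 1" for n using add_mono[of 1 1 0 "- (real n * (x - a))"] by (simp add: s_def)
        then show ?thesis using True by simp
      next
        case False
        obtain N where N: "1 < real N * (x - a)" using False reals_Archimedean3[of "x - a"] by auto
        have "s n x = 0" if "n \<ge> N" for n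
        proof -
          have "real N * (x - a) \<le> real n * (x - a)" using that False by (intro mult_right_mono) auto
          with N show ?thesis by (simp add: s_def)
        qed
        then show ?thesis using False by (auto simp: eventually_sequentially)
      qed
    qed
    show "cmod (complex_of_real (s n x)) \<le> 1" for n x by (simp add: s_def)
  qed auto
  have indicator: "indicator A \<in> ?V" if "A \<in> sets borel" for A :: "real set"
  proof -
    have "Int_stable (range (\<lambda>a::real. {..a}))"
      by (auto simp: Int_stable_def)
    moreover have "range (\<lambda>a::real. {..a}) \<subseteq> Pow UNIV" by simp
    moreover have "A \<in> sigma_sets UNIV (range (\<lambda>a::real. {..a}))"
      using that unfolding borel_eq_atMost by simp
    ultimately show ?thesis
    proof (induction rule: sigma_sets_induct_disjoint)
      case (basic A)
      then show ?case using atMost by auto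
    next
      case empty
      show ?case using L2_closure_cmult[OF expo[of 0], of 0] by (simp add: indicator_def)
    next
      case (compl A)
      have "(\<lambda>x. expo 0 x + (- 1) * indicator A x) \<in> ?V"
        by (intro L2_closure_add[OF B] expo L2_closure_cmult compl)
      also have "(\<lambda>x. expo 0 x + (- 1) * indicator A x) = (indicator (UNIV - A) :: real \<Rightarrow> complex)"
        by (auto simp: indicator_def fun_eq_iff)
      finally show ?case .
    next
      case (union A)
      have "A i \<in> sets borel" for i
        using union(2) unfolding borel_eq_atMost by auto
      then have [measurable]: "(\<Union>i. A i) \<in> sets borel" by auto
      show ?case
      proof (rule L2_closure_dominated[OF B, where w = "\<lambda>x. 1"])
        show "indicator (\<Union>i<n. A i) \<in> ?V" for n :: nat
        proof -
          have "disjoint_family_on A {..<n}" using union(1) by (auto simp: disjoint_family_on_def)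
          then have "(indicator (\<Union>i<n. A i) :: real \<Rightarrow> complex) = (\<lambda>x. \<Sum>i<n. indicator (A i) x)"
            by (intro ext indicator_UN_disjoint) auto
          then show ?thesis using L2_closure_sum[OF B _ union(3), of "{..<n}"] by simp
        qed
        show "(\<lambda>n. indicator (\<Union>i<n. A i) x) \<longlonglongrightarrow> (indicator (\<Union>i. A i) x :: complex)" for x
          by (rule LIMSEQ_indicator_UN)
        show "indicator (\<Union>i. A i) \<in> borel_measurable \<mu>" by simp
        show "cmod (indicator (\<Union>i<n. A i) x) \<le> 1" for n x by (simp add: indicator_def)
      qed auto
    qed
  qed
  have simple: "f \<in> ?V" if f: "simple_function \<mu> f" for f
  proof -
    have "f = (\<lambda>x. \<Sum>y\<in>range f. y * indicator (f -` {y}) x)"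
    proof
      fix x
      show "f x = (\<Sum>y\<in>range f. y * indicator (f -` {y}) x)"
        by (subst simple_function_indicator_representation_banach[OF f])
           (auto simp: scaleR_conv_of_real indicator_def intro!: sum.cong)
    qed
    also have "\<dots> \<in> ?V"
    proof (rule L2_closure_sum[OF B])
      show "finite (range f)" using simple_functionD(1)[OF f] by simp
      fix y assume "y \<in> range f"
      then show "(\<lambda>x. y * indicator (f -` {y}) x) \<in> ?V"
        using simple_functionD(2)[OF f, of "{y}"] by (intro L2_closure_cmult indicator) (simp add: sets_mu)
    qed
    finally show ?thesis .
  qed
  show ?thesis
  proof
    fix f assume f: "f \<in> L2_fun \<mu>"
    then have [measurable]: "f \<in> borel_measurable \<mu>" and int: "integrable \<mu> (\<lambda>x. (cmod (f x))\<^sup>2)"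
      by (auto simp: L2_fun_def)
    obtain s where s: "\<And>i. simple_function \<mu> (s i)" "\<And>x. (\<lambda>i. s i x) \<longlonglongrightarrow> f x"
        "\<And>i x. dist (s i x) 0 \<le> 2 * dist (f x) 0"
      using borel_measurable_implies_sequence_metric[OF \<open>f \<in> borel_measurable \<mu>\<close>, of 0]
      unfolding space_mu by auto
    show "f \<in> ?V"
    proof (rule L2_closure_dominated[OF B, where w = "\<lambda>x. 2 * cmod (f x)"])
      show "s i \<in> ?V" for i by (rule simple[OF s(1)])
      show "f \<in> borel_measurable \<mu>" by fact
      show "integrable \<mu> (\<lambda>x. (2 * cmod (f x))\<^sup>2)" using int by (simp add: power_mult_distrib)
    qed (use s in auto)
  qed
qed

section \<open>Spectra of the measure\<close>

lemma inner_expo: "L2_inner \<mu> (expo a) (expo b) = ft (a - b)"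
  by (simp add: L2_inner_def ft_def expo_mult)

text \<open>Pythagoras' theorem for the distance of \<open>expo t\<close> to a finite orthonormal set of exponentials.\<close>

lemma expo_distance:
  assumes "finite A" and orth: "\<And>a b. a \<in> A \<Longrightarrow> b \<in> A \<Longrightarrow> a \<noteq> b \<Longrightarrow> ft (a - b) = 0"
  shows "(LINT x|\<mu>. (cmod (expo t x - (\<Sum>a\<in>A. ft (t - a) * expo a x)))\<^sup>2) = 1 - (\<Sum>a\<in>A. ft_sq (t - a))"
proof -
  define c where "c a = ft (t - a)" for a
  have cc: "c a * cnj (c a) = complex_of_real (ft_sq (t - a))" for a
    by (simp only: c_def ft_sq_def complex_norm_square)
  have c_cnj: "ft (a - t) = cnj (c a)" for a
    using ft_minus[of "t - a"] by (simp add: c_def)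
  have "complex_of_real ((cmod (expo t x - (\<Sum>a\<in>A. c a * expo a x)))\<^sup>2) =
      1 - (\<Sum>b\<in>A. cnj (c b) * expo (t - b) x) - (\<Sum>a\<in>A. c a * expo (a - t) x) +
      (\<Sum>a\<in>A. \<Sum>b\<in>A. c a * cnj (c b) * expo (a - b) x)" for x
  proof -
    have "complex_of_real ((cmod (expo t x - (\<Sum>a\<in>A. c a * expo a x)))\<^sup>2) =
        (expo t x - (\<Sum>a\<in>A. c a * expo a x)) * (expo (- t) x - (\<Sum>b\<in>A. cnj (c b) * expo (- b) x))"
      unfolding complex_norm_square by simp
    also have "\<dots> = expo t x * expo (- t) x - (\<Sum>b\<in>A. cnj (c b) * (expo t x * expo (- b) x)) -
        (\<Sum>a\<in>A. c a * (expo a x * expo (- t) x)) +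
        (\<Sum>a\<in>A. \<Sum>b\<in>A. c a * cnj (c b) * (expo a x * expo (- b) x))"
    proof -
      have "(u - X) * (v - Y) = u * v - u * Y - X * v + X * Y" for u v X Y :: complex
        by (simp add: algebra_simps)
      then show ?thesis
        unfolding sum_product
        by (simp add: sum_distrib_left sum_distrib_right mult_ac) (rule sum.swap)
    qed
    finally show ?thesis by (simp add: expo_mult)
  qed
  then have "complex_of_real (LINT x|\<mu>. (cmod (expo t x - (\<Sum>a\<in>A. c a * expo a x)))\<^sup>2) =
      (LINT x|\<mu>. 1 - (\<Sum>b\<in>A. cnj (c b) * expo (t - b) x) - (\<Sum>a\<in>A. c a * expo (a - t) x) +
      (\<Sum>a\<in>A. \<Sum>b\<in>A. c a * cnj (c b) * expo (a - b) x))"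
    unfolding integral_complex_of_real[symmetric] by (simp only:)
  also have "\<dots> = 1 - (\<Sum>b\<in>A. cnj (c b) * ft (t - b)) - (\<Sum>a\<in>A. c a * ft (a - t)) +
      (\<Sum>a\<in>A. \<Sum>b\<in>A. c a * cnj (c b) * ft (a - b))"
    by (simp add: ft_def)
  also have "(\<Sum>a\<in>A. \<Sum>b\<in>A. c a * cnj (c b) * ft (a - b)) = (\<Sum>a\<in>A. c a * cnj (c a))"
  proof (rule sum.cong[OF refl])
    fix a assume a: "a \<in> A"
    have "(\<Sum>b\<in>A. c a * cnj (c b) * ft (a - b)) = (\<Sum>b\<in>A. if b = a then c a * cnj (c a) else 0)"
      using orth a by (intro sum.cong) (auto simp: ft_0)
    also have "\<dots> = c a * cnj (c a)" using a \<open>finite A\<close> by simp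
    finally show "(\<Sum>b\<in>A. c a * cnj (c b) * ft (a - b)) = c a * cnj (c a)" .
  qed
  also have "1 - (\<Sum>b\<in>A. cnj (c b) * ft (t - b)) - (\<Sum>a\<in>A. c a * ft (a - t)) + (\<Sum>a\<in>A. c a * cnj (c a)) =
      1 - (\<Sum>a\<in>A. c a * cnj (c a))"
    by (simp add: c_cnj mult.commute flip: c_def)
  also have "\<dots> = complex_of_real (1 - (\<Sum>a\<in>A. ft_sq (t - a)))"
    by (simp add: cc)
  finally show ?thesis unfolding c_def of_real_eq_iff .
qed

lemma spectral_pair:
  assumes "odd p" and dvd: "int p dvd 4 ^ N + 1"
  shows "L2_orthonormal_basis \<mu> (expo ` (\<lambda>x. real p * x) ` Gamma1)"
proof -
  define \<Lambda> where "\<Lambda> = (\<lambda>x. real p * x) ` Gamma1"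
  define A where "A n = (\<lambda>g. real p * real g) ` digit_sums n" for n
  have \<Lambda>_eq: "\<Lambda> = (\<Union>n. A n)" unfolding \<Lambda>_def A_def Gamma1_eq by auto
  have A_mono: "m \<le> n \<Longrightarrow> A m \<subseteq> A n" for m n
    unfolding A_def by (intro image_mono digit_sums_mono)
  have orth: "ft (a - b) = 0" if ab: "a \<in> \<Lambda>" "b \<in> \<Lambda>" "a \<noteq> b" for a b
  proof -
    obtain m n where "a \<in> A m" "b \<in> A n" using ab unfolding \<Lambda>_eq by auto
    then have "a \<in> A (max m n)" "b \<in> A (max m n)" using A_mono[of m "max m n"] A_mono[of n "max m n"] by auto
    then obtain g h where gh: "g \<in> digit_sums (max m n)" "h \<in> digit_sums (max m n)" "a = real p * real g" "b = real p * real h"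
      by (auto simp: A_def)
    with ab have "ft_sq (a - b) = 0"
      using ft_sq_digit_diff[OF \<open>odd p\<close> gh(1,2)] by (auto simp: right_diff_distrib)
    then show ?thesis by (simp add: ft_sq_def)
  qed
  have inj: "inj_on expo \<Lambda>"
  proof (rule inj_onI, rule ccontr)
    fix a b assume ab: "a \<in> \<Lambda>" "b \<in> \<Lambda>" "expo a = expo b" "a \<noteq> b"
    then have "ft (a - b) = ft (a - a)" by (metis inner_expo)
    with orth[OF ab(1,2,4)] show False by (simp add: ft_0)
  qed
  define B where "B = expo ` \<Lambda>"
  have B: "B \<subseteq> L2_fun \<mu>" using expo_L2_fun by (auto simp: B_def)
  have "expo t \<in> L2_closure \<mu> B" for t
  proof (rule L2_closureI[OF expo_L2_fun])
    fix \<epsilon> :: real assume "\<epsilon> > 0"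
    then have "eventually (\<lambda>n. energy p n (- t) > 1 - \<epsilon>) sequentially"
      by (intro order_tendstoD(1)[OF energy_tendsto_1[OF assms]]) simp
    then obtain n where n: "energy p n (- t) > 1 - \<epsilon>" by (auto simp: eventually_sequentially)
    have A\<Lambda>: "A n \<subseteq> \<Lambda>" using \<Lambda>_eq by auto
    have "(\<Sum>a\<in>A n. ft_sq (t - a)) = (\<Sum>g\<in>digit_sums n. ft_sq (t - real p * real g))"
      using odd_pos[OF \<open>odd p\<close>] unfolding A_def by (subst sum.reindex) (auto simp: inj_on_def)
    also have "\<dots> = energy p n (- t)"
      unfolding energy_def
    proof (rule sum.cong[OF refl])
      fix g show "ft_sq (t - real p * real g) = ft_sq (- t + real p * real g)"
        using ft_sq_minus[of "t - real p * real g"] by simp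
    qed
    finally have energy: "(\<Sum>a\<in>A n. ft_sq (t - a)) = energy p n (- t)" .
    define c where "c g = ft (t - inv_into \<Lambda> expo g)" for g
    have "(\<Sum>g\<in>expo ` A n. c g * g x) = (\<Sum>a\<in>A n. ft (t - a) * expo a x)" for x
    proof -
      have "(\<Sum>g\<in>expo ` A n. c g * g x) = (\<Sum>a\<in>A n. c (expo a) * expo a x)"
        using inj_on_subset[OF inj A\<Lambda>] by (subst sum.reindex) auto
      also have "\<dots> = (\<Sum>a\<in>A n. ft (t - a) * expo a x)"
        using A\<Lambda> inj by (intro sum.cong) (auto simp: c_def)
      finally show ?thesis .
    qed
    then have "(LINT x|\<mu>. (cmod (expo t x - (\<Sum>g\<in>expo ` A n. c g * g x)))\<^sup>2) =
        (LINT x|\<mu>. (cmod (expo t x - (\<Sum>a\<in>A n. ft (t - a) * expo a x)))\<^sup>2)" by simp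
    also have "\<dots> = 1 - (\<Sum>a\<in>A n. ft_sq (t - a))"
      using orth A\<Lambda> by (intro expo_distance) (auto simp: A_def)
    also have "\<dots> < \<epsilon>" using n by (simp add: energy)
    finally show "\<exists>S c. finite S \<and> S \<subseteq> B \<and> (LINT x|\<mu>. (cmod (expo t x - (\<Sum>g\<in>S. c g * g x)))\<^sup>2) < \<epsilon>"
      using A\<Lambda> by (intro exI[of _ "expo ` A n"] exI[of _ c]) (auto simp: B_def A_def)
  qed
  then have complete: "L2_fun \<mu> \<subseteq> L2_closure \<mu> B"
    by (rule L2_fun_subset_closure[OF B])
  have "L2_orthonormal_basis \<mu> B"
    unfolding L2_orthonormal_basis_def
  proof (intro conjI ballI allI impI)
    show "B \<subseteq> L2_fun \<mu>" by (rule B)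
    fix f g assume "f \<in> B" "g \<in> B"
    then obtain a b where ab: "f = expo a" "g = expo b" "a \<in> \<Lambda>" "b \<in> \<Lambda>" by (auto simp: B_def)
    show "L2_inner \<mu> f g = (if f = g then 1 else 0)"
    proof (cases "a = b")
      case False
      then show ?thesis using orth[OF ab(3,4)] inj_onD[OF inj _ ab(3,4)] by (auto simp: ab inner_expo)
    qed (simp add: ab inner_expo ft_0)
  next
    fix f and \<epsilon> :: real assume "f \<in> L2_fun \<mu>" "\<epsilon> > 0"
    then obtain S c where S: "finite S" "S \<subseteq> B" "(LINT x|\<mu>. (cmod (f x - (\<Sum>g\<in>S. c g * g x)))\<^sup>2) < \<epsilon>\<^sup>2"
      using L2_closureD[of f \<mu> B "\<epsilon>\<^sup>2"] complete by auto
    then have "L2_nrm \<mu> (\<lambda>x. f x - (\<Sum>g\<in>S. c g * g x)) < \<epsilon>"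
      unfolding L2_nrm_def using \<open>\<epsilon> > 0\<close> by (intro real_less_lsqrt) auto
    with S show "\<exists>S c. finite S \<and> S \<subseteq> B \<and> L2_nrm \<mu> (\<lambda>x. f x - (\<Sum>g\<in>S. c g * g x)) < \<epsilon>" by blast
  qed
  then show ?thesis by (simp add: B_def \<Lambda>_def)
qed

end

theorem mainTheorem8:
  fixes \<mu> :: "real measure"
  assumes "sets \<mu> = sets borel"
    and "prob_space \<mu>"
    and "\<forall>A\<in>sets borel. measure \<mu> A =
           1 / 2 * (measure (distr \<mu> borel (tau 0)) A + measure (distr \<mu> borel (tau 2)) A)"
  shows "0 < upper_beurling_density (1 / 2) Gamma1 \<and>
    upper_beurling_density (1 / 2) Gamma1 < \<infinity> \<and>
    (\<forall>k::nat. upper_beurling_density (1 / 2) ((\<lambda>x. 5 ^ k * x) ` Gamma1) =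
       ennreal (1 / (5 ^ k) powr (1 / 2)) * upper_beurling_density (1 / 2) Gamma1) \<and>
    (\<lambda>k::nat. upper_beurling_density (1 / 2) ((\<lambda>x. 5 ^ k * x) ` Gamma1)) \<longlonglongrightarrow> 0 \<and>
    (\<forall>\<epsilon>::real. \<epsilon> > 0 \<longrightarrow>
       (\<exists>\<Lambda>::real set. L2_orthonormal_basis \<mu> (expo ` \<Lambda>) \<and>
          upper_beurling_density (1 / 2) \<Lambda> < ennreal \<epsilon>))"
proof -
  interpret prob_space \<mu> by (rule assms(2))
  interpret quarter_cantor_measure \<mu> by unfold_locales (rule assms(1), rule assms(3))
  let ?D = "upper_beurling_density (1 / 2) Gamma1"
  have pos: "0 < ?D"
    using upper_beurling_density_Gamma1_ge
    by (rule less_le_trans[rotated]) (subst ennreal_less_zero_iff, simp)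
  have finite: "?D < \<infinity>"
    using upper_beurling_density_Gamma1_le by (rule le_less_trans) simp
  have scale: "upper_beurling_density (1 / 2) ((\<lambda>x. 5 ^ k * x) ` Gamma1) =
      ennreal (1 / (5 ^ k) powr (1 / 2)) * ?D" for k :: nat
    by (rule upper_beurling_density_scale) simp
  have "(\<lambda>k::nat. upper_beurling_density (1 / 2) ((\<lambda>x. 5 ^ k * x) ` Gamma1)) \<longlonglongrightarrow> ennreal 0 * ?D"
    unfolding scale
  proof (intro tendsto_mult_ennreal tendsto_ennrealI tendsto_const)
    have "(\<lambda>k. (1 / sqrt 5) ^ k) \<longlonglongrightarrow> 0" by (rule LIMSEQ_realpow_zero) auto
    moreover have "1 / (5 ^ k :: real) powr (1 / 2) = (1 / sqrt 5) ^ k" for k :: nat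
      by (simp add: powr_half_sqrt real_sqrt_power power_one_over)
    ultimately show "(\<lambda>k::nat. 1 / (5 ^ k :: real) powr (1 / 2)) \<longlonglongrightarrow> 0" by (simp only:)
  qed (use finite in auto)
  then have lim: "(\<lambda>k::nat. upper_beurling_density (1 / 2) ((\<lambda>x. 5 ^ k * x) ` Gamma1)) \<longlonglongrightarrow> 0" by simp
  have "\<exists>\<Lambda>. L2_orthonormal_basis \<mu> (expo ` \<Lambda>) \<and> upper_beurling_density (1 / 2) \<Lambda> < ennreal \<epsilon>"
    if "\<epsilon> > 0" for \<epsilon> :: real
  proof -
    have "0 < ennreal \<epsilon>" using that by simp
    then have "eventually (\<lambda>k::nat. upper_beurling_density (1 / 2) ((\<lambda>x. 5 ^ k * x) ` Gamma1) < ennreal \<epsilon>) sequentially"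
      by (rule order_tendstoD(2)[OF lim])
    then obtain k :: nat where k: "upper_beurling_density (1 / 2) ((\<lambda>x. 5 ^ k * x) ` Gamma1) < ennreal \<epsilon>"
      by (auto simp: eventually_sequentially)
    obtain N where "int (5 ^ k) dvd 4 ^ N + 1" using five_power_dvd by blast
    then have "L2_orthonormal_basis \<mu> (expo ` (\<lambda>x. 5 ^ k * x) ` Gamma1)"
      using spectral_pair[of "5 ^ k" N] by simp
    with k show ?thesis by blast
  qed
  with pos finite scale lim show ?thesis by blast
qed

end
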